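(* Let $n>1$ be a natural number. If there is a strongly homogeneous Souslin tree, then there is an $n$-free Souslin tree which is not $(n-1)$-absolutely rigid.
   Context: A tree is a partial order $(T,<_T)$ in which the set of predecessors of every node $t$ is well-ordered by $<_T$; its order type is the height $\mathrm{ht}(t)$ of $t$. $T_\alpha$ is the set of nodes of height $\alpha$, and the height of $T$ is the least $\alpha$ with $T_\alpha=\emptyset$. For $t\in T$, $T(t)=\{s\in T: t\le_T s\}$ with the inherited order. $T$ is $\aleph_0$-splitting if every node that is not a leaf has exactly $\aleph_0$ immediate successors. $T$ is normal if: (a) there is a single minimal node (the root); (b) each node $s$ with $\mathrm{ht}(s)+1<\mathrm{ht}\,T$ has at least two immediate successors; (c) each node has successors in every higher non-empty level; (d) nodes of the same limit height with the same set of predecessors are equal. An antichain is a set of pairwise incomparable nodes; $T$ satisfies the c.c.c. if all its antichains are countable. A branch is a linearly ordered, downward closed subset. A Souslin tree is a tree of height $\omega_1$ all of whose antichains and all of whose branches are countable. Convention: all Souslin trees are assumed normal and $\aleph_0$-splitting. For trees $T^i$ ($i\in I$) of the same height $\mu$, the tree product is $\bigotimes_{i\in I}T^i=\bigcup_{\alpha<\mu}\prod_{i\in I}T^i_\alpha$ with the coordinatewise tree order. A Souslin tree $T$ is strongly homogeneous if there is a family $(\psi_{st}\mid s,t\in T,\ \mathrm{ht}(s)=\mathrm{ht}(t))$ (a coherent family) such that: (1) $\psi_{st}:T(s)\to T(t)$ is a tree isomorphism and $\psi_{ss}$ is the identity; (2) $\psi_{rt}=\psi_{st}\circ\psi_{rs}$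 for all $r,s,t$ of the same level; (3) if $r,s$ are on the same level, $t$ is above $r$ and $u=\psi_{rs}(t)$, then $\psi_{tu}$ is the restriction of $\psi_{rs}$ to $T(t)$; (4) if $t,u$ are on the same limit level $T_\alpha$, then there is $\gamma<\alpha$ such that for the predecessors $r$ of $t$ and $s$ of $u$ on level $T_\gamma$ we have $\psi_{rs}(t)=u$. For a positive natural number $n$, a Souslin tree $T$ is $n$-free if for every subset $P$ of size $n$ of some level $T_\alpha$, $\alpha<\omega_1$, the tree product $\bigotimes_{s\in P}T(s)$ satisfies the c.c.c. A tree is rigid if it has no non-trivial automorphism. Forcing with a tree always uses the inverse of the tree order (the root is the largest condition). For a positive natural number $k$, a Souslin tree $T$ is $k$-absolutely rigid if $T$ is a rigid tree in the generic extension obtained by forcing with the $k$-fold product $T^k$ (equivalently, with the $k$-fold tree product $T^{\otimes k}$), i.e. in every such generic extension. *)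

theory Defs
  imports Main "HOL-Library.FuncSet" "HOL-Library.Countable_Set"
begin

unbundle cardinal_syntax

section \<open>Trees\<close>

text \<open>
  A tree is represented by its reflexive order relation \<open>r\<close>; its set of nodes is \<open>Field r\<close>, and
  \<open>underS r t\<close> is the set of strict predecessors of \<open>t\<close>. Ordinals are represented by
  well-order relations up to \<open>=o\<close>.
\<close>

definition is_tree :: "'a rel \<Rightarrow> bool" where
  "is_tree r \<longleftrightarrow> Partial_order r \<and> (\<forall>t\<in>Field r. Well_order (Restr r (underS r t)))"

definition ht :: "'a rel \<Rightarrow> 'a \<Rightarrow> 'a rel" where
  "ht r t = Restr r (underS r t)"

text \<open>The order type of the predecessors of \<open>t\<close> together with \<open>t\<close> itself is \<open>ht(t) + 1\<close>.\<close>

definition ht_succ :: "'a rel \<Rightarrow> 'a \<Rightarrow> 'a rel" where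
  "ht_succ r t = Restr r (under r t)"

definition limit_ht :: "'a rel \<Rightarrow> 'a \<Rightarrow> bool" where
  "limit_ht r t \<longleftrightarrow> underS r t \<noteq> {} \<and> (\<forall>b\<in>underS r t. \<exists>c\<in>underS r t. b \<in> underS r c)"

definition level :: "'a rel \<Rightarrow> 'b rel \<Rightarrow> 'a set" where
  "level r \<alpha> = {t \<in> Field r. ht r t =o \<alpha>}"

text \<open>
  Every ordinal below \<open>\<mu>\<close> is represented by a well-order on the type on which \<open>\<mu>\<close> lives, so
  quantifying over relations of that type loses nothing.
\<close>

definition has_height :: "'a rel \<Rightarrow> 'b rel \<Rightarrow> bool" where
  "has_height r \<mu> \<longleftrightarrow> Well_order \<mu> \<and> level r \<mu> = {} \<and> (\<forall>\<alpha> :: 'b rel. \<alpha> <o \<mu> \<longrightarrow> level r \<alpha> \<noteq> {})"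

definition cone :: "'a rel \<Rightarrow> 'a \<Rightarrow> 'a rel" where
  "cone r t = Restr r (above r t)"

definition imm_succs :: "'a rel \<Rightarrow> 'a \<Rightarrow> 'a set" where
  "imm_succs r s = {t \<in> Field r. s \<in> underS r t \<and> \<not> (\<exists>u. s \<in> underS r u \<and> u \<in> underS r t)}"

definition leaf :: "'a rel \<Rightarrow> 'a \<Rightarrow> bool" where
  "leaf r s \<longleftrightarrow> s \<in> Field r \<and> \<not> (\<exists>t. s \<in> underS r t)"

definition aleph0_splitting :: "'a rel \<Rightarrow> bool" where
  "aleph0_splitting r \<longleftrightarrow>
     (\<forall>s\<in>Field r. \<not> leaf r s \<longrightarrow> countable (imm_succs r s) \<and> infinite (imm_succs r s))"

definition normal_tree :: "'a rel \<Rightarrow> 'b rel \<Rightarrow> bool" where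
  "normal_tree r \<mu> \<longleftrightarrow> has_height r \<mu> \<and>
     (\<exists>!t. t \<in> Field r \<and> underS r t = {}) \<and>
     (\<forall>s\<in>Field r. ht_succ r s <o \<mu> \<longrightarrow> (\<exists>t\<in>imm_succs r s. \<exists>u\<in>imm_succs r s. t \<noteq> u)) \<and>
     (\<forall>s\<in>Field r. \<forall>\<alpha> :: 'b rel. ht r s <o \<alpha> \<and> level r \<alpha> \<noteq> {} \<longrightarrow> (\<exists>t\<in>level r \<alpha>. (s, t) \<in> r)) \<and>
     (\<forall>s\<in>Field r. \<forall>t\<in>Field r. limit_ht r s \<and> ht r s =o ht r t \<and> underS r s = underS r t
        \<longrightarrow> s = t)"

definition antichain :: "'a rel \<Rightarrow> 'a set \<Rightarrow> bool" where
  "antichain r A \<longleftrightarrow> A \<subseteq> Field r \<and> (\<forall>s\<in>A. \<forall>t\<in>A. s \<noteq> t \<longrightarrow> (s, t) \<notin> r \<and> (t, s) \<notin> r)"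

definition ccc :: "'a rel \<Rightarrow> bool" where
  "ccc r \<longleftrightarrow> (\<forall>A. antichain r A \<longrightarrow> countable A)"

definition branch :: "'a rel \<Rightarrow> 'a set \<Rightarrow> bool" where
  "branch r B \<longleftrightarrow> B \<subseteq> Field r \<and> (\<forall>s\<in>B. \<forall>t\<in>B. (s, t) \<in> r \<or> (t, s) \<in> r) \<and> (\<forall>t\<in>B. underS r t \<subseteq> B)"

definition omega1 :: "nat set rel" where
  "omega1 = cardSuc natLeq"

text \<open>Souslin trees are by convention normal and \<open>\<aleph>\<^sub>0\<close>-splitting.\<close>

definition souslin_tree :: "'a rel \<Rightarrow> bool" where
  "souslin_tree r \<longleftrightarrow> is_tree r \<and> has_height r omega1 \<and> ccc r \<and> (\<forall>B. branch r B \<longrightarrow> countable B) \<and>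
     normal_tree r omega1 \<and> aleph0_splitting r"


section \<open>Strong homogeneity and freeness\<close>

definition tree_iso :: "'a rel \<Rightarrow> 'b rel \<Rightarrow> ('a \<Rightarrow> 'b) \<Rightarrow> bool" where
  "tree_iso r r' f \<longleftrightarrow> bij_betw f (Field r) (Field r') \<and>
     (\<forall>x\<in>Field r. \<forall>y\<in>Field r. (x, y) \<in> r \<longleftrightarrow> (f x, f y) \<in> r')"

definition same_level :: "'a rel \<Rightarrow> 'a \<Rightarrow> 'a \<Rightarrow> bool" where
  "same_level r s t \<longleftrightarrow> s \<in> Field r \<and> t \<in> Field r \<and> ht r s =o ht r t"

text \<open>
  Only the values of \<open>\<psi> s t\<close> on the cone above \<open>s\<close>, for \<open>s\<close> and \<open>t\<close> of the same height, matter.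
  In the last clause, \<open>\<gamma>\<close> is an ordinal below the height of \<open>t\<close>, and \<open>r\<close> and \<open>s\<close> are the (unique)
  predecessors of \<open>t\<close> and \<open>u\<close> on level \<open>\<gamma>\<close>.
\<close>

definition coherent_family :: "'a rel \<Rightarrow> ('a \<Rightarrow> 'a \<Rightarrow> 'a \<Rightarrow> 'a) \<Rightarrow> bool" where
  "coherent_family T \<psi> \<longleftrightarrow>
     (\<forall>s t. same_level T s t \<longrightarrow> tree_iso (cone T s) (cone T t) (\<psi> s t)) \<and>
     (\<forall>s\<in>Field T. \<forall>x\<in>above T s. \<psi> s s x = x) \<and>
     (\<forall>r s t. same_level T r s \<and> same_level T s t \<longrightarrow>
        (\<forall>x\<in>above T r. \<psi> r t x = \<psi> s t (\<psi> r s x))) \<and>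
     (\<forall>r s. same_level T r s \<longrightarrow>
        (\<forall>t\<in>above T r. \<forall>u. u = \<psi> r s t \<longrightarrow> (\<forall>x\<in>above T t. \<psi> t u x = \<psi> r s x))) \<and>
     (\<forall>t u. same_level T t u \<and> limit_ht T t \<longrightarrow>
        (\<exists>\<gamma> :: 'a rel. \<gamma> <o ht T t \<and>
           (\<forall>r\<in>underS T t \<inter> level T \<gamma>. \<forall>s\<in>underS T u \<inter> level T \<gamma>. \<psi> r s t = u)))"

definition strongly_homogeneous :: "'a rel \<Rightarrow> bool" where
  "strongly_homogeneous T \<longleftrightarrow> souslin_tree T \<and> (\<exists>\<psi>. coherent_family T \<psi>)"

definition tree_product_nodes :: "'b rel \<Rightarrow> 'i set \<Rightarrow> ('i \<Rightarrow> 'a rel) \<Rightarrow> ('i \<Rightarrow> 'a) set" where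
  "tree_product_nodes \<mu> I T = (\<Union>\<alpha>\<in>{\<alpha> :: 'b rel. \<alpha> <o \<mu>}. \<Pi>\<^sub>E i\<in>I. level (T i) \<alpha>)"

text \<open>Here \<open>\<mu>\<close> is the common height of the factors.\<close>

definition tree_product :: "'b rel \<Rightarrow> 'i set \<Rightarrow> ('i \<Rightarrow> 'a rel) \<Rightarrow> ('i \<Rightarrow> 'a) rel" where
  "tree_product \<mu> I T = {(f, g). f \<in> tree_product_nodes \<mu> I T \<and> g \<in> tree_product_nodes \<mu> I T \<and>
     (\<forall>i\<in>I. (f i, g i) \<in> T i)}"

definition n_free :: "nat \<Rightarrow> 'a rel \<Rightarrow> bool" where
  "n_free n T \<longleftrightarrow> souslin_tree T \<and>
     (\<forall>\<alpha> :: nat set rel. \<alpha> <o omega1 \<longrightarrow>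
        (\<forall>P. P \<subseteq> level T \<alpha> \<and> finite P \<and> card P = n \<longrightarrow> ccc (tree_product omega1 P (cone T))))"


section \<open>The forcing relation\<close>

text \<open>
  A forcing is given by its reflexive order relation \<open>P\<close>, where \<open>(q, p) \<in> P\<close> means that \<open>q\<close> is
  stronger than \<open>p\<close>. A formula of the forcing language is identified with the predicate ``\<open>p\<close>
  forces the formula''; the operations below are the usual recursive clauses of the forcing
  relation, the remaining connectives being abbreviations by their classical definitions from
  negation, conjunction and universal quantification.

  The first-order variables range over a set of the ground model. The second-order variables range
  over the subsets, in the generic extension, of a ground model set \<open>X\<close>; each such subset has a
  name consisting of pairs of (the canonical name of) an element of \<open>X\<close> and a condition, so that
  the quantifier ranges over the subsets of \<open>X \<times> Field P\<close>.
\<close>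

type_synonym 'p forced = "'p \<Rightarrow> bool"

definition f_neg :: "'p rel \<Rightarrow> 'p forced \<Rightarrow> 'p forced" where
  "f_neg P \<phi> = (\<lambda>p. \<not> (\<exists>q. (q, p) \<in> P \<and> \<phi> q))"

definition f_and :: "'p forced \<Rightarrow> 'p forced \<Rightarrow> 'p forced" (infixr "and\<^sub>f" 35) where
  "(\<phi> and\<^sub>f \<psi>) = (\<lambda>p. \<phi> p \<and> \<psi> p)"

definition f_all :: "'x set \<Rightarrow> ('x \<Rightarrow> 'p forced) \<Rightarrow> 'p forced" where
  "f_all X \<phi> = (\<lambda>p. \<forall>x\<in>X. \<phi> x p)"

definition f_imp :: "'p rel \<Rightarrow> 'p forced \<Rightarrow> 'p forced \<Rightarrow> 'p forced" where
  "f_imp P \<phi> \<psi> = f_neg P (\<phi> and\<^sub>f f_neg P \<psi>)"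

definition f_ex :: "'p rel \<Rightarrow> 'x set \<Rightarrow> ('x \<Rightarrow> 'p forced) \<Rightarrow> 'p forced" where
  "f_ex P X \<phi> = f_neg P (f_all X (\<lambda>x. f_neg P (\<phi> x)))"

text \<open>
  Atomic statements about elements of the ground model (equality, or the tree order) are absolute:
  they are forced by every condition if true, and by no condition otherwise.
\<close>

definition f_ground :: "bool \<Rightarrow> 'p forced" where
  "f_ground b = (\<lambda>p. b)"

definition names :: "'p rel \<Rightarrow> 'x set \<Rightarrow> ('x \<times> 'p) set set" where
  "names P X = Pow (X \<times> Field P)"

text \<open>
  \<open>p\<close> forces \<open>x \<in> F\<close> iff the conditions lying below some \<open>s\<close> with \<open>(x, s) \<in> F\<close> are dense below \<open>p\<close>.
\<close>

definition f_mem :: "'p rel \<Rightarrow> 'x \<Rightarrow> ('x \<times> 'p) set \<Rightarrow> 'p forced" where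
  "f_mem P x F = (\<lambda>p. \<forall>q. (q, p) \<in> P \<longrightarrow> (\<exists>r. (r, q) \<in> P \<and> (\<exists>s. (x, s) \<in> F \<and> (r, s) \<in> P)))"


section \<open>Absolute rigidity\<close>

text \<open>
  The formula ``\<open>F\<close> is the graph of an automorphism of the tree \<open>T\<close>'': \<open>F\<close> is total and
  surjective, and it is single-valued, injective, and preserves and reflects the order.
\<close>

definition f_automorphism :: "'p rel \<Rightarrow> 'a rel \<Rightarrow> (('a \<times> 'a) \<times> 'p) set \<Rightarrow> 'p forced" where
  "f_automorphism P T F =
     (f_all (Field T) (\<lambda>x. f_ex P (Field T) (\<lambda>y. f_mem P (x, y) F)) and\<^sub>f
      f_all (Field T) (\<lambda>y. f_ex P (Field T) (\<lambda>x. f_mem P (x, y) F)) and\<^sub>f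
      f_all (Field T) (\<lambda>x. f_all (Field T) (\<lambda>x'. f_all (Field T) (\<lambda>y. f_all (Field T) (\<lambda>y'.
        f_imp P (f_mem P (x, y) F and\<^sub>f f_mem P (x', y') F)
                (f_ground (x = x' \<longleftrightarrow> y = y') and\<^sub>f f_ground ((x, x') \<in> T \<longleftrightarrow> (y, y') \<in> T)))))))"

definition f_rigid :: "'p rel \<Rightarrow> 'a rel \<Rightarrow> 'p forced" where
  "f_rigid P T = f_all (names P (Field T \<times> Field T)) (\<lambda>F.
     f_imp P (f_automorphism P T F) (f_all (Field T) (\<lambda>x. f_mem P (x, x) F)))"

text \<open>The full \<open>k\<close>-fold product, whose nodes are all \<open>k\<close>-tuples of nodes.\<close>

definition product_power :: "nat \<Rightarrow> 'a rel \<Rightarrow> (nat \<Rightarrow> 'a) rel" where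
  "product_power k T = {(f, g). f \<in> (\<Pi>\<^sub>E i\<in>{..<k}. Field T) \<and> g \<in> (\<Pi>\<^sub>E i\<in>{..<k}. Field T) \<and>
     (\<forall>i<k. (f i, g i) \<in> T)}"

text \<open>
  Forcing with \<open>T\<^sup>k\<close> uses the inverse order. A statement holds in every generic extension iff it is
  forced by all conditions. Being a tree is preserved in every extension, so that only the absence
  of a nontrivial automorphism has to be forced.
\<close>

definition absolutely_rigid :: "nat \<Rightarrow> 'a rel \<Rightarrow> bool" where
  "absolutely_rigid k T \<longleftrightarrow> souslin_tree T \<and>
     (\<forall>p\<in>Field ((product_power k T)\<inverse>). f_rigid ((product_power k T)\<inverse>) T p)"

end

theory Submission
  imports Defs "HOL-Computational_Algebra.Polynomial"
begin

text \<open>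
  Let \<open>S\<close> be a strongly homogeneous Souslin tree with coherent family \<open>\<psi>\<close>. The tree \<open>T\<close> of the
  theorem is a quotient of \<open>S\<close>. Identify the immediate successors of each node of \<open>S\<close> with the
  rational polynomials of degree less than \<open>n\<close>, in a way that the maps \<open>\<psi> s t\<close> respect. Level by
  level, assign to the equivalence classes that have been formed on a level pairwise distinct
  rationals (there are only countably many nodes), and declare two immediate successors of equivalent
  nodes equivalent if their polynomials agree at the rational assigned to the class of these nodes; on
  limit levels two nodes are equivalent if their predecessors are. So a class with the rational \<open>c\<close>
  splits according to the value at \<open>c\<close>, the maps \<open>\<psi> s t\<close> between equivalent nodes preserve the
  equivalence, and the quotient is again a Souslin tree.

  Polynomial interpolation controls how the quotient looks on different cones simultaneously. Let
  \<open>A\<close> consist of pairwise inequivalent nodes on one level, and send a node \<open>t\<close> above a fixed node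
  \<open>s\<close> of that level to the tuple of the classes of \<open>\<psi> s a t\<close>, for \<open>a \<in> A\<close>. If \<open>A\<close> has at most
  \<open>n\<close> elements, every tuple of nodes of one level is obtained in this way, because a polynomial of
  degree less than \<open>n\<close> can take prescribed values at \<open>n\<close> points; limit levels are no obstacle because
  of coherence (\<open>joint_surjectivity\<close>). If \<open>A\<close> has exactly \<open>n\<close> elements, the tuple determines \<open>t\<close>,
  because the polynomial is unique (\<open>joint_injectivity\<close>).

  Surjectivity yields \<open>n\<close>-freeness: an antichain in a product of \<open>n\<close> cones of \<open>T\<close> lifts to an
  antichain of \<open>S\<close>. Injectivity destroys rigidity: take distinct immediate successors
  \<open>x 0, \<dots>, x n\<close> of one node of \<open>T\<close>, and let \<open>b i\<close> be generic branches through \<open>x i\<close> for \<open>i < n - 1\<close>.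
  A node \<open>y\<close> above \<open>x (n - 1)\<close> together with the branches \<open>b i\<close> determines, by both statements
  for these \<open>n\<close> cones, a unique \<open>t\<close> in \<open>S\<close>, and \<open>t\<close> determines a node above \<open>x n\<close>. This is
  an isomorphism between the cones of \<open>x (n - 1)\<close> and \<open>x n\<close>, and exchanging these two cones along
  it is a nontrivial automorphism of \<open>T\<close>.
\<close>

section \<open>Heights in trees\<close>

lemma order_isomorphic_Restr:
  assumes W: "Well_order (Restr r A)" and refl: "\<And>a. a \<in> A \<Longrightarrow> (a, a) \<in> r"
    and f: "bij_betw f A B"
    and ord: "\<And>a b. a \<in> A \<Longrightarrow> b \<in> A \<Longrightarrow> (a, b) \<in> r \<longleftrightarrow> (f a, f b) \<in> r'"
  shows "Well_order (Restr r' B)" and "Restr r A =o Restr r' B"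
proof -
  have F: "Field (Restr r A) = A" using refl by (auto simp: Field_def)
  have eq: "Restr r' B = dir_image (Restr r A) f"
    using f ord by (fastforce simp: dir_image_def bij_betw_def)
  have inj: "inj_on f (Field (Restr r A))" using f F by (simp add: bij_betw_def)
  show "Well_order (Restr r' B)" unfolding eq by (rule Well_order_dir_image[OF W inj])
  show "Restr r A =o Restr r' B" unfolding eq by (rule dir_image_ordIso[OF W inj])
qed

lemma underS_I: "(a, b) \<in> r \<Longrightarrow> a \<noteq> b \<Longrightarrow> a \<in> underS r b"
  by (simp add: underS_def)

lemma underS_le: "a \<in> underS r b \<Longrightarrow> (a, b) \<in> r"
  by (simp add: underS_def)

lemma underS_ne: "a \<in> underS r b \<Longrightarrow> a \<noteq> b"
  by (simp add: underS_def)

locale tree =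
  fixes r :: "'a rel"
  assumes tree: "is_tree r"
begin

lemma partial_order: "Partial_order r"
  using tree by (simp add: is_tree_def)

lemma le_refl: "t \<in> Field r \<Longrightarrow> (t, t) \<in> r"
  using partial_order by (auto simp: partial_order_on_def preorder_on_def refl_on_def)

lemma le_trans: "(a, b) \<in> r \<Longrightarrow> (b, c) \<in> r \<Longrightarrow> (a, c) \<in> r"
  using partial_order by (auto simp: partial_order_on_def preorder_on_def trans_def)

lemma le_antisym: "(a, b) \<in> r \<Longrightarrow> (b, a) \<in> r \<Longrightarrow> a = b"
  using partial_order by (auto simp: partial_order_on_def antisym_def)

lemma le_FieldD: assumes "(a, b) \<in> r" shows "a \<in> Field r" "b \<in> Field r"
  using assms by (auto simp: Field_def)

lemma underS_trans: "a \<in> underS r b \<Longrightarrow> b \<in> underS r c \<Longrightarrow> a \<in> underS r c"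
  unfolding underS_def using le_trans le_antisym by blast

lemma le_underS_trans: "(a, b) \<in> r \<Longrightarrow> b \<in> underS r c \<Longrightarrow> a \<in> underS r c"
  unfolding underS_def using le_trans le_antisym by blast

lemma underS_le_trans: "a \<in> underS r b \<Longrightarrow> (b, c) \<in> r \<Longrightarrow> a \<in> underS r c"
  unfolding underS_def using le_trans le_antisym by blast

lemma underS_FieldD: assumes "a \<in> underS r b" shows "a \<in> Field r" "b \<in> Field r"
  using assms by (auto simp: Field_def underS_def)

lemma Field_Restr_underS: "Field (Restr r (underS r t)) = underS r t"
proof -
  have "\<And>x. x \<in> underS r t \<Longrightarrow> (x, x) \<in> r" by (meson le_refl underS_FieldD)
  then show ?thesis by (auto simp: Field_def)
qed

lemma Well_order_ht: "Well_order (ht r t)"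
proof (cases "t \<in> Field r")
  case True then show ?thesis using tree by (simp add: is_tree_def ht_def)
next
  case False
  then have "underS r t = {}" by (auto simp: underS_def Field_def)
  then show ?thesis by (simp add: ht_def well_order_on_def linear_order_on_def partial_order_on_def
        preorder_on_def refl_on_def trans_def antisym_def total_on_def)
qed

lemma comparable:
  assumes "(a, t) \<in> r" "(b, t) \<in> r" shows "(a, b) \<in> r \<or> (b, a) \<in> r"
proof (cases "a = t \<or> b = t \<or> a = b")
  case True then show ?thesis using assms le_refl le_FieldD by metis
next
  case False
  then have "a \<in> Field (ht r t)" "b \<in> Field (ht r t)"
    unfolding ht_def Field_Restr_underS using assms by (auto simp: underS_def)
  then show ?thesis using Well_order_ht[of t] False
    by (auto simp: well_order_on_def linear_order_on_def total_on_def ht_def)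
qed

text \<open>The strict tree order is well-founded because each set of predecessors is well-ordered.\<close>

lemma wf_underS: "wf {(a, b). a \<in> underS r b}"
  unfolding wf_eq_minimal
proof (intro allI impI)
  fix Q :: "'a set" and x assume x: "x \<in> Q"
  show "\<exists>z\<in>Q. \<forall>y. (y, z) \<in> {(a, b). a \<in> underS r b} \<longrightarrow> y \<notin> Q"
  proof (cases "Q \<inter> underS r x = {}")
    case True then show ?thesis using x by blast
  next
    case False
    have "wf (ht r x - Id)" using Well_order_ht[of x] by (simp add: well_order_on_def)
    then obtain z where z: "z \<in> Q \<inter> underS r x"
      and min: "\<And>y. (y, z) \<in> ht r x - Id \<Longrightarrow> y \<notin> Q \<inter> underS r x"
      using False unfolding wf_eq_minimal by (metis ex_in_conv)
    have "y \<notin> Q" if "y \<in> underS r z" for y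
      using min[of y] that z underS_trans[of y z x] by (auto simp: ht_def underS_def)
    then show ?thesis using z by auto
  qed
qed

lemma ht_below: "s \<in> underS r t \<Longrightarrow> Restr (ht r t) (underS (ht r t) s) = ht r s"
  unfolding ht_def using underS_trans[of _ s t] by (auto simp: underS_def)

lemma ht_less: assumes "s \<in> underS r t" shows "ht r s <o ht r t"
proof -
  have "Field (ht r t) \<noteq> {}" using assms by (auto simp: ht_def Field_Restr_underS)
  from underS_Restr_ordLess[OF Well_order_ht this] show ?thesis
    using ht_below[OF assms] by metis
qed

lemma ht_attained_below:
  assumes "\<alpha> <o ht r t" shows "\<exists>s\<in>underS r t. ht r s =o \<alpha>"
proof -
  have "Well_order \<alpha>" using assms by (auto simp: ordLess_def)
  then obtain a where "a \<in> Field (ht r t)" "\<alpha> =o Restr (ht r t) (underS (ht r t) a)"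
    using assms ordLess_iff_ordIso_Restr[OF Well_order_ht] by blast
  then show ?thesis using ht_below ordIso_symmetric by (metis Field_Restr_underS ht_def)
qed

lemma ht_le: "(s, t) \<in> r \<Longrightarrow> ht r s \<le>o ht r t"
  by (metis ht_less ordLess_imp_ordLeq ordLeq_reflexive Well_order_ht underS_I)

lemma ht_trichotomy: "ht r s =o ht r t \<or> ht r s <o ht r t \<or> ht r t <o ht r s"
  using Well_order_ht ordLess_or_ordLeq ordLeq_iff_ordLess_or_ordIso by blast

lemma same_level_refl: "s \<in> Field r \<Longrightarrow> same_level r s s"
  by (simp add: same_level_def ordIso_reflexive Well_order_ht)

lemma same_level_sym: "same_level r s t \<Longrightarrow> same_level r t s"
  by (simp add: same_level_def ordIso_symmetric)

lemma same_level_trans: "same_level r s t \<Longrightarrow> same_level r t u \<Longrightarrow> same_level r s u"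
  unfolding same_level_def using ordIso_transitive by blast

lemma same_level_FieldD: assumes "same_level r s t" shows "s \<in> Field r" "t \<in> Field r"
  using assms by (auto simp: same_level_def)

lemma same_level_not_underS: "same_level r s t \<Longrightarrow> s \<notin> underS r t"
  unfolding same_level_def using ht_less not_ordLess_ordIso by blast

lemma same_level_le_eq: "same_level r s t \<Longrightarrow> (s, t) \<in> r \<Longrightarrow> s = t"
  using same_level_not_underS underS_I by metis

lemma same_level_below_eq: "same_level r a b \<Longrightarrow> (a, t) \<in> r \<Longrightarrow> (b, t) \<in> r \<Longrightarrow> a = b"
  using comparable same_level_le_eq same_level_sym by metis

text \<open>
  Nodes below a common node are comparable, and their heights decide in which direction. So an order
  relation between two nodes carries over to any nodes of the same levels that lie below a common node.
\<close>

lemma le_transfer: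
  assumes "same_level r a b" "same_level r a' b'" "(a, a') \<in> r" "(b, t) \<in> r" "(b', t) \<in> r"
  shows "(b, b') \<in> r"
proof (rule ccontr)
  assume n: "(b, b') \<notin> r"
  then have "(b', b) \<in> r" "b' \<noteq> b" using comparable[OF assms(4,5)] le_refl le_FieldD assms by metis+
  then have "ht r b' <o ht r b" by (simp add: ht_less underS_I)
  moreover have "ht r b =o ht r a" "ht r a' =o ht r b'" using assms by (auto simp: same_level_def ordIso_symmetric)
  ultimately have "ht r a' <o ht r a" using ordIso_ordLess_trans ordLess_ordIso_trans by blast
  then show False using ht_le[OF assms(3)] not_ordLess_ordLeq by blast
qed

lemma underS_transfer:
  assumes "same_level r a b" "same_level r a' b'" "a \<in> underS r a'" "(b, t) \<in> r" "(b', t) \<in> r"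
  shows "b \<in> underS r b'"
proof -
  have "(b, b') \<in> r" using le_transfer assms underS_le by metis
  moreover have "b \<noteq> b'" using assms same_level_trans same_level_sym same_level_not_underS by metis
  ultimately show ?thesis by (rule underS_I)
qed

lemma counterpart_below:
  assumes "same_level r s t" "s' \<in> underS r s" shows "\<exists>t'\<in>underS r t. same_level r s' t'"
proof -
  have "ht r s' <o ht r t" using assms ht_less ordLess_ordIso_trans unfolding same_level_def by blast
  then obtain t' where "t' \<in> underS r t" "ht r t' =o ht r s'" using ht_attained_below by blast
  then show ?thesis using assms unfolding same_level_def
    by (meson ordIso_symmetric underS_FieldD)
qed

lemma counterpart_below_eq:
  assumes "same_level r s t" "(s', s) \<in> r" shows "\<exists>t'. (t', t) \<in> r \<and> same_level r s' t'"
  using assms counterpart_below underS_le underS_I le_refl same_level_FieldD by metis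

lemma root_or_imm_succ_or_limit:
  assumes "t \<in> Field r" shows "underS r t = {} \<or> (\<exists>s. t \<in> imm_succs r s) \<or> limit_ht r t"
proof -
  { assume "underS r t \<noteq> {}" "\<not> limit_ht r t"
    then have "\<exists>b. b \<in> underS r t \<and> \<not> (\<exists>c\<in>underS r t. b \<in> underS r c)"
      by (auto simp: limit_ht_def)
    then have "\<exists>b. t \<in> imm_succs r b" using assms by (auto simp: imm_succs_def) }
  then show ?thesis by blast
qed

lemma imm_succ_underS: "t \<in> imm_succs r s \<Longrightarrow> s \<in> underS r t"
  by (simp add: imm_succs_def)

lemma below_imm_succ:
  assumes "t \<in> imm_succs r s" "a \<in> underS r t" shows "(a, s) \<in> r"
  using assms comparable[of a t s] underS_I[of s a r]
  by (auto simp: imm_succs_def underS_def)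

lemma imm_succ_same_level:
  assumes t: "t \<in> imm_succs r s" and l: "same_level r s s'" "same_level r t t'" and s': "s' \<in> underS r t'"
  shows "t' \<in> imm_succs r s'"
proof -
  { fix u assume u: "s' \<in> underS r u" "u \<in> underS r t'"
    obtain v where v: "v \<in> underS r t" "same_level r u v"
      using counterpart_below l u same_level_sym by metis
    have "s \<in> underS r v"
      using underS_transfer[of s' s u v t] l u v t same_level_sym imm_succ_underS underS_le by metis
    then have False using v t by (auto simp: imm_succs_def) }
  then show ?thesis using l s' by (auto simp: imm_succs_def same_level_def)
qed

lemma imm_succs_same_level:
  assumes "same_level r s s'" "t \<in> imm_succs r s" "t' \<in> imm_succs r s'" shows "same_level r t t'"
proof -
  have aux: False if a: "same_level r s s'" "t \<in> imm_succs r s" "t' \<in> imm_succs r s'" "ht r t <o ht r t'" for s s' t t'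
  proof -
    obtain v where v: "v \<in> underS r t'" "ht r v =o ht r t" using ht_attained_below[OF a(4)] by blast
    then have tv: "same_level r t v" using that underS_FieldD by (auto simp: same_level_def ordIso_symmetric imm_succs_def)
    have "s' \<in> underS r v"
      using underS_transfer[OF that(1) tv imm_succ_underS[OF that(2)] underS_le[OF imm_succ_underS[OF that(3)]] underS_le[OF v(1)]] .
    then show False using v that by (auto simp: imm_succs_def)
  qed
  show ?thesis using aux[OF assms] aux[OF same_level_sym[OF assms(1)] assms(3,2)] ht_trichotomy assms
    unfolding same_level_def by (auto simp: imm_succs_def)
qed

lemma imm_succ_below_eq:
  assumes "t \<in> imm_succs r s" "t' \<in> imm_succs r s" "(t, u) \<in> r" "(t', u) \<in> r" shows "t = t'"
  using assms imm_succs_same_level same_level_below_eq same_level_refl underS_FieldD imm_succ_underS by metis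

lemma imm_succ_below:
  assumes "s \<in> underS r t" shows "\<exists>!u. u \<in> imm_succs r s \<and> (u, t) \<in> r"
proof -
  have "t \<in> {u. s \<in> underS r u \<and> (u, t) \<in> r}" using assms le_refl underS_FieldD by simp
  from wfE_min[OF wf_underS this] obtain z where z: "s \<in> underS r z" "(z, t) \<in> r"
    and m: "\<And>y. y \<in> underS r z \<Longrightarrow> \<not> (s \<in> underS r y \<and> (y, t) \<in> r)" by auto
  have "z \<in> imm_succs r s"
    using z m unfolding imm_succs_def
    by (blast intro: underS_FieldD underS_le le_trans)
  then show ?thesis using z imm_succ_below_eq by blast
qed

text \<open>
  The immediate successor of \<open>s\<close> through which the way from \<open>s\<close> to \<open>t\<close> passes; it is meaningful
  only if \<open>s\<close> lies strictly below \<open>t\<close>.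
\<close>

definition next_to :: "'a \<Rightarrow> 'a \<Rightarrow> 'a" where
  "next_to s t = (THE u. u \<in> imm_succs r s \<and> (u, t) \<in> r)"

lemma next_to: assumes "s \<in> underS r t" shows "next_to s t \<in> imm_succs r s" "(next_to s t, t) \<in> r"
  using theI'[OF imm_succ_below[OF assms]] by (auto simp: next_to_def)

lemma next_to_eq: "u \<in> imm_succs r s \<Longrightarrow> (u, t) \<in> r \<Longrightarrow> next_to s t = u"
  using imm_succ_below_eq next_to imm_succ_underS underS_le_trans by metis

lemma next_to_le: assumes "s \<in> underS r t" "(t, t') \<in> r" shows "next_to s t' = next_to s t"
  using next_to[OF assms(1)] assms next_to_eq le_trans by metis

lemma limit_ht_same_level:
  assumes "same_level r s t" "limit_ht r s" shows "limit_ht r t"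
proof -
  have "\<exists>c\<in>underS r t. b \<in> underS r c" if b: "b \<in> underS r t" for b
  proof -
    obtain b' where b': "b' \<in> underS r s" "same_level r b b'" using counterpart_below assms b same_level_sym by metis
    then obtain c' where c': "c' \<in> underS r s" "b' \<in> underS r c'" using assms by (auto simp: limit_ht_def)
    then obtain c where c: "c \<in> underS r t" "same_level r c' c" using counterpart_below assms by metis
    have "b \<in> underS r c"
      by (rule underS_transfer[OF same_level_sym[OF b'(2)] c(2) c'(2) underS_le[OF b] underS_le[OF c(1)]])
    then show ?thesis using c by blast
  qed
  moreover have "underS r t \<noteq> {}" using assms counterpart_below unfolding limit_ht_def by blast
  ultimately show ?thesis by (auto simp: limit_ht_def)
qed

subsection \<open>Heights in cones\<close>

lemma Field_cone: "s \<in> Field r \<Longrightarrow> Field (cone r s) = above r s"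
proof -
  assume s: "s \<in> Field r"
  have "(x, x) \<in> cone r s" if "x \<in> above r s" for x
    using that le_refl le_FieldD by (auto simp: cone_def above_def)
  then show ?thesis by (auto simp: cone_def Field_def)
qed

lemma ht_cone: "(s, t) \<in> r \<Longrightarrow> ht (cone r s) t = Restr r {z. (s, z) \<in> r \<and> z \<in> underS r t}"
  unfolding ht_def cone_def above_def underS_def by auto

lemma cone_le_iff: "(x, y) \<in> cone r s \<longleftrightarrow> (s, x) \<in> r \<and> (x, y) \<in> r"
  unfolding cone_def above_def using le_trans by blast

lemma Well_order_segment: "Well_order (Restr r {z. (s, z) \<in> r \<and> z \<in> underS r t})"
proof -
  have "Restr r {z. (s, z) \<in> r \<and> z \<in> underS r t} = Restr (ht r t) {z. (s, z) \<in> r \<and> z \<in> underS r t}"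
    by (auto simp: ht_def)
  then show ?thesis using Well_order_Restr[OF Well_order_ht, of t "{z. (s, z) \<in> r \<and> z \<in> underS r t}"] by argo
qed

lemma ht_cone_less:
  assumes "(s, w) \<in> r" "w \<in> underS r t" shows "ht (cone r s) w <o ht (cone r s) t"
proof -
  have st: "(s, t) \<in> r" using assms le_trans underS_le by metis
  let ?R = "Restr r {z. (s, z) \<in> r \<and> z \<in> underS r t}"
  have w: "(w, w) \<in> ?R" using assms le_refl underS_FieldD by simp
  then have "Field ?R \<noteq> {}" by (auto simp: Field_def)
  from underS_Restr_ordLess[OF Well_order_segment this] 
  have "Restr ?R (underS ?R w) <o ?R" .
  moreover have "Restr ?R (underS ?R w) = Restr r {z. (s, z) \<in> r \<and> z \<in> underS r w}"
    using w assms underS_trans[of _ w t] by (auto simp: underS_def)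
  ultimately show ?thesis unfolding ht_cone[OF assms(1)] ht_cone[OF st] by argo
qed

text \<open>An isomorphism between the predecessors of \<open>t\<close> and those of \<open>t'\<close> preserves the height in
  the whole tree, hence maps what lies above \<open>s\<close> to what lies above the node of the same level below \<open>t'\<close>.\<close>

lemma ht_cone_same_level:
  assumes s: "same_level r s s'" and t: "same_level r t t'" and le: "(s, t) \<in> r" "(s', t') \<in> r"
  shows "ht (cone r s) t =o ht (cone r s') t'"
proof -
  define f where "f = (\<lambda>z. SOME z'. z' \<in> underS r t' \<and> same_level r z z')"
  have f: "f z \<in> underS r t'" "same_level r z (f z)" if "z \<in> underS r t" for z
    using someI_ex[of "\<lambda>z'. z' \<in> underS r t' \<and> same_level r z z'"] counterpart_below[OF t that] unfolding f_def by blast+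
  have ord: "(a, b) \<in> r \<longleftrightarrow> (f a, f b) \<in> r" if "a \<in> underS r t" "b \<in> underS r t" for a b
  proof
    note [intro] = underS_le f same_level_sym that
    show "(a, b) \<in> r \<Longrightarrow> (f a, f b) \<in> r" by (rule le_transfer[of a _ b _ t']) auto
    show "(f a, f b) \<in> r \<Longrightarrow> (a, b) \<in> r" by (rule le_transfer[of "f a" _ "f b" _ t]) auto
  qed
  have ords: "(s, b) \<in> r \<longleftrightarrow> (s', f b) \<in> r" if "b \<in> underS r t" for b
  proof
    note [intro] = underS_le f same_level_sym that le s
    show "(s, b) \<in> r \<Longrightarrow> (s', f b) \<in> r" by (rule le_transfer[of s _ b _ t']) auto
    show "(s', f b) \<in> r \<Longrightarrow> (s, b) \<in> r" by (rule le_transfer[of s' _ "f b" _ t]) auto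
  qed
  let ?A = "{z. (s, z) \<in> r \<and> z \<in> underS r t}" and ?B = "{z. (s', z) \<in> r \<and> z \<in> underS r t'}"
  have "bij_betw f ?A ?B"
  proof (rule bij_betwI')
    fix x y assume "x \<in> ?A" "y \<in> ?A"
    then show "f x = f y \<longleftrightarrow> x = y" using f same_level_trans same_level_sym same_level_below_eq underS_le
      by (metis (no_types, lifting) mem_Collect_eq)
  next
    fix x assume "x \<in> ?A" then show "f x \<in> ?B" using f ords by auto
  next
    fix y assume y: "y \<in> ?B"
    then obtain z where z: "z \<in> underS r t" "same_level r y z" using counterpart_below t same_level_sym by blast
    then have "f z = y" using f[OF z(1)] y same_level_trans same_level_below_eq underS_le by (metis (no_types, lifting) mem_Collect_eq)
    then show "\<exists>x\<in>?A. y = f x" using z y ords by blast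
  qed
  then have "Restr r ?A =o Restr r ?B"
    by (intro order_isomorphic_Restr(2)[OF Well_order_segment, where f = f])
      (use le_refl underS_FieldD ord in blast)+
  then show ?thesis unfolding ht_cone[OF le(1)] ht_cone[OF le(2)] .
qed

text \<open>
  The levels of a tree product of cones refer to the heights inside the cones. If the cones start
  on the same level, these heights determine the level in the whole tree; otherwise the node of the
  lower level would have a counterpart strictly below the other node, of the same height in the cone.
\<close>

lemma same_level_if_ht_cone:
  assumes s: "same_level r s s'" and le: "(s, t) \<in> r" "(s', t') \<in> r"
    and ht: "ht (cone r s) t =o ht (cone r s') t'"
  shows "same_level r t t'"
proof -
  have aux: False if s: "same_level r s s'" and le: "(s, t) \<in> r" "(s', t') \<in> r"
    and ht: "ht (cone r s) t =o ht (cone r s') t'" and lt: "ht r t <o ht r t'" for s s' t t'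
  proof -
    obtain w where w: "w \<in> underS r t'" "ht r w =o ht r t" using ht_attained_below lt by blast
    then have tw: "same_level r t w" using le le_FieldD underS_FieldD unfolding same_level_def by (metis ordIso_symmetric)
    have sw: "(s', w) \<in> r" using le_transfer[OF s tw le] underS_le[OF w(1)] .
    have "ht (cone r s) t =o ht (cone r s') w" using ht_cone_same_level s tw le sw by blast
    then have "ht (cone r s') t' =o ht (cone r s') w" using ht ordIso_symmetric ordIso_transitive by blast
    then show False using ht_cone_less[OF sw w(1)] not_ordLess_ordIso ordIso_symmetric by blast
  qed
  show ?thesis
    using aux[OF assms] aux[OF same_level_sym[OF s] le(2,1) ordIso_symmetric[OF ht]] ht_trichotomy le
    unfolding same_level_def using le_FieldD by blast
qed

end

section \<open>Interpolation over the rationals\<close>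

text \<open>
  A polynomial with the prescribed values on \<open>A\<close> is corrected at a further point by a multiple of the
  polynomial that vanishes exactly at the points of \<open>A\<close>. For empty \<open>A\<close> the
  zero polynomial, of degree 0, forces the bound 1.
\<close>

lemma interpolation_exists:
  fixes v :: "'i \<Rightarrow> 'b::field"
  assumes "finite A" and "inj_on x A"
  shows "\<exists>p. degree p < max 1 (card A) \<and> (\<forall>a\<in>A. poly p (x a) = v a)"
  using assms
proof (induction A rule: finite_induct)
  case empty
  have "degree (0 :: 'b poly) < max 1 (card ({} :: 'i set))" by simp
  then show ?case by blast
next
  case (insert b A)
  then obtain p where p: "degree p < max 1 (card A)" "\<forall>a\<in>A. poly p (x a) = v a" by auto
  define q where "q = (\<Prod>a\<in>A. [:- x a, 1:])"
  have dq: "degree q \<le> card A"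
    unfolding q_def using degree_prod_sum_le[OF insert.hyps(1), of "\<lambda>a. [:- x a, 1:]"] by simp
  have q0: "poly q (x a) = 0" if "a \<in> A" for a
    unfolding q_def poly_prod using that insert.hyps(1) by (auto intro!: prod_zero)
  have qb: "poly q (x b) \<noteq> 0"
    using insert.prems insert.hyps by (auto simp: q_def poly_prod inj_on_def)
  define P where "P = p + smult ((v b - poly p (x b)) / poly q (x b)) q"
  have "degree P < max 1 (card (insert b A))"
  proof -
    have "degree P \<le> max (degree p) (degree q)"
      unfolding P_def by (meson degree_add_le_max degree_smult_le max.mono order_refl order_trans)
    then show ?thesis using p(1) dq insert.hyps by auto
  qed
  moreover have "\<forall>a\<in>insert b A. poly P (x a) = v a"
    using p(2) q0 qb by (auto simp: P_def)
  ultimately show ?case by blast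
qed

lemma countable_rat_poly: "countable (X :: rat poly set)"
proof -
  have "surj (Poly :: rat list \<Rightarrow> rat poly)" by (rule surjI[where f = coeffs]) simp
  then have "countable (UNIV :: rat poly set)"
    using countable_image[OF countableI_type, of "Poly :: rat list \<Rightarrow> rat poly" UNIV] by simp
  then show ?thesis by (rule countable_subset[OF subset_UNIV])
qed

definition low_degree :: "nat \<Rightarrow> rat poly set" where
  "low_degree n = {p. degree p < n}"

lemma infinite_low_degree: assumes "n > 0" shows "infinite (low_degree n)"
proof -
  have "(\<lambda>c::rat. [:c:]) ` UNIV \<subseteq> low_degree n" using assms by (auto simp: low_degree_def)
  moreover have "infinite ((\<lambda>c::rat. [:c:]) ` UNIV)"
    by (subst finite_image_iff) (auto simp: inj_on_def infinite_UNIV_char_0)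
  ultimately show ?thesis using finite_subset by blast
qed

section \<open>Souslin trees and coherent families\<close>

lemma omega1_card: "Card_order omega1" "\<not> finite (Field omega1)"
proof -
  have n: "Card_order natLeq" by (rule natLeq_Card_order)
  show "Card_order omega1" unfolding omega1_def by (rule cardSuc_Card_order[OF n])
  show "\<not> finite (Field omega1)"
    unfolding omega1_def using cardSuc_finite[OF n] by (simp add: Field_natLeq)
qed

lemma omega1_Well_order: "Well_order omega1"
  using omega1_card(1) by (simp add: card_order_on_def)

lemma omega1_limit:
  assumes "\<alpha> <o omega1" shows "\<exists>\<beta> :: nat set rel. \<alpha> <o \<beta> \<and> \<beta> <o omega1"
proof -
  have W: "Well_order \<alpha>" using assms by (auto simp: ordLess_def)
  obtain a where a: "a \<in> Field omega1" "\<alpha> =o Restr omega1 (underS omega1 a)"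
    using ordLess_iff_ordIso_Restr[OF omega1_Well_order W] assms by blast
  obtain b where b: "b \<in> Field omega1" "a \<noteq> b" "(a, b) \<in> omega1"
    using infinite_Card_order_limit[OF omega1_card a(1)] by blast
  let ?\<beta> = "Restr omega1 (underS omega1 b)"
  have Wb: "Well_order ?\<beta>" by (rule Well_order_Restr[OF omega1_Well_order])
  have po: "trans omega1" "antisym omega1" "refl_on (Field omega1) omega1"
    using omega1_Well_order by (auto simp: order_on_defs)
  have "(a, a) \<in> ?\<beta>" using a b po(3) by (auto simp: underS_def refl_on_def)
  then have aF: "a \<in> Field ?\<beta>" by (auto simp: Field_def)
  have "Restr ?\<beta> (underS ?\<beta> a) = Restr omega1 (underS omega1 a)"
  proof -
    have "(c, b) \<in> omega1 \<and> c \<noteq> b" if "(c, a) \<in> omega1" "c \<noteq> a" for c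
      using that b po(1,2) unfolding trans_def antisym_def by metis
    then show ?thesis using b by (auto simp: underS_def)
  qed
  then have "\<alpha> <o ?\<beta>" using ordLess_iff_ordIso_Restr[OF Wb W] aF a(2) by metis
  moreover have "?\<beta> <o omega1" using underS_Restr_ordLess[OF omega1_Well_order] b(1) by blast
  ultimately show ?thesis by blast
qed

locale normal_souslin = tree S for S :: "'a rel" +
  assumes souslin: "souslin_tree S"
begin

lemma ht_less_omega1: assumes "s \<in> Field S" shows "ht S s <o omega1"
proof (rule ccontr)
  have e: "level S omega1 = {}" using souslin by (simp add: souslin_tree_def has_height_def)
  assume "\<not> ht S s <o omega1"
  then have "omega1 \<le>o ht S s" using not_ordLess_iff_ordLeq[OF omega1_Well_order Well_order_ht] by blast
  then consider "omega1 <o ht S s" | "omega1 =o ht S s" using ordLeq_iff_ordLess_or_ordIso by blast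
  then show False
  proof cases
    case 1
    then obtain t where "t \<in> underS S s" "ht S t =o omega1" using ht_attained_below by blast
    then show False using e underS_FieldD by (auto simp: level_def)
  next
    case 2 then show False using e assms ordIso_symmetric by (auto simp: level_def)
  qed
qed

lemma extend_to_level:
  assumes "s \<in> Field S" "t \<in> Field S" shows "\<exists>s'. (s, s') \<in> S \<and> (same_level S s' t \<or> ht S t <o ht S s')"
proof (cases "ht S s <o ht S t")
  case True
  obtain \<alpha> :: "nat set rel" where a: "ht S t =o \<alpha>" "\<alpha> <o omega1"
    using iffD1[OF internalize_ordLess ht_less_omega1[OF assms(2)]] by blast
  have "level S \<alpha> \<noteq> {}" using souslin a by (auto simp: souslin_tree_def has_height_def)
  moreover have "ht S s <o \<alpha>" using True a ordLess_ordIso_trans by blast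
  ultimately obtain s' where "s' \<in> level S \<alpha>" "(s, s') \<in> S"
    using souslin assms(1) unfolding souslin_tree_def normal_tree_def by metis
  then show ?thesis using a assms unfolding level_def same_level_def
    by (metis (mono_tags, lifting) mem_Collect_eq ordIso_symmetric ordIso_transitive)
next
  case False
  then show ?thesis using ht_trichotomy[of s t] assms le_refl by (auto simp: same_level_def)
qed

text \<open>
  \<open>omega1\<close> is a limit ordinal, so there are nonempty levels above that of \<open>s\<close>, and normality provides
  extensions there.
\<close>

lemma not_leaf: assumes "s \<in> Field S" shows "\<not> leaf S s"
proof -
  obtain \<alpha> :: "nat set rel" where a: "ht S s <o \<alpha>" "\<alpha> <o omega1"
    using omega1_limit[OF ht_less_omega1[OF assms]] by blast
  have "level S \<alpha> \<noteq> {}" using souslin a by (auto simp: souslin_tree_def has_height_def)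
  then obtain t where t: "t \<in> level S \<alpha>" "(s, t) \<in> S"
    using souslin assms(1) a unfolding souslin_tree_def normal_tree_def by metis
  have "s \<noteq> t" using t a not_ordLess_ordIso by (auto simp: level_def)
  then show ?thesis using t underS_I by (metis leaf_def)
qed

lemma imm_succs_denumerable:
  assumes "s \<in> Field S" shows "countable (imm_succs S s)" "infinite (imm_succs S s)"
  using souslin not_leaf assms by (auto simp: souslin_tree_def aleph0_splitting_def)

lemma countable_same_level: "countable {t. same_level S s t}"
proof -
  have "antichain S {t. same_level S s t}"
    unfolding antichain_def
  proof (intro conjI ballI impI)
    show "{t. same_level S s t} \<subseteq> Field S" using same_level_FieldD by blast
    fix t u assume "t \<in> {t. same_level S s t}" "u \<in> {t. same_level S s t}" and ne: "t \<noteq> u"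
    then have "same_level S t u" using same_level_trans[OF same_level_sym] by blast
    then show "(t, u) \<notin> S" "(u, t) \<notin> S" using same_level_le_eq same_level_sym ne by metis+
  qed
  then show ?thesis using souslin by (auto simp: souslin_tree_def ccc_def)
qed

end

locale coherent_souslin = normal_souslin S for S :: "'a rel" +
  fixes \<psi> :: "'a \<Rightarrow> 'a \<Rightarrow> 'a \<Rightarrow> 'a"
  assumes coherent: "coherent_family S \<psi>"
begin

lemma psi_iso: "same_level S s t \<Longrightarrow> tree_iso (cone S s) (cone S t) (\<psi> s t)"
  using coherent by (simp add: coherent_family_def)

lemma psi_above: assumes "same_level S s t" "(s, x) \<in> S" shows "(t, \<psi> s t x) \<in> S"
proof -
  have "\<psi> s t ` Field (cone S s) = Field (cone S t)" using psi_iso[OF assms(1)] by (auto simp: tree_iso_def bij_betw_def)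
  then show ?thesis using assms Field_cone same_level_FieldD by (fastforce simp: above_def)
qed

lemma psi_le_iff:
  assumes "same_level S s t" "(s, x) \<in> S" "(s, y) \<in> S"
  shows "(\<psi> s t x, \<psi> s t y) \<in> S \<longleftrightarrow> (x, y) \<in> S"
proof -
  have "x \<in> Field (cone S s)" "y \<in> Field (cone S s)"
    using assms Field_cone same_level_FieldD by (auto simp: above_def)
  then have "(x, y) \<in> cone S s \<longleftrightarrow> (\<psi> s t x, \<psi> s t y) \<in> cone S t"
    using psi_iso[OF assms(1)] by (auto simp: tree_iso_def)
  then show ?thesis using assms psi_above by (simp add: cone_le_iff)
qed

lemma psi_id: "(s, x) \<in> S \<Longrightarrow> \<psi> s s x = x"
  using coherent le_FieldD by (auto simp: coherent_family_def above_def)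

lemma psi_comp: "same_level S r s \<Longrightarrow> same_level S s t \<Longrightarrow> (r, x) \<in> S \<Longrightarrow> \<psi> s t (\<psi> r s x) = \<psi> r t x"
  using coherent unfolding coherent_family_def above_def by (metis mem_Collect_eq)

lemma psi_inverse: "same_level S s t \<Longrightarrow> (s, x) \<in> S \<Longrightarrow> \<psi> t s (\<psi> s t x) = x"
  using psi_comp same_level_sym psi_id by metis

lemma psi_root: assumes "same_level S s t" shows "\<psi> s t s = t"
proof -
  have st: "(s, s) \<in> S" "(t, t) \<in> S" using assms le_refl same_level_FieldD by metis+
  have 1: "(s, \<psi> t s t) \<in> S" by (rule psi_above[OF same_level_sym[OF assms] st(2)])
  have "(\<psi> s t s, \<psi> s t (\<psi> t s t)) \<in> S" using psi_le_iff[OF assms st(1) 1] 1 by blast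
  then have "(\<psi> s t s, t) \<in> S" using psi_inverse[OF same_level_sym[OF assms] st(2)] by simp
  then show ?thesis using psi_above[OF assms st(1)] le_antisym by blast
qed

lemma psi_restrict:
  assumes "same_level S s t" "(s, u) \<in> S" "(u, x) \<in> S" shows "\<psi> u (\<psi> s t u) x = \<psi> s t x"
  using coherent assms unfolding coherent_family_def above_def by blast

text \<open>
  The isomorphism between the cones preserves heights inside the cones; to see that it preserves
  the height in the whole tree, suppose that \<open>x\<close> and its image are of different heights. A node strictly below
  the higher one, on the level of the lower one, corresponds to a node strictly below the lower one,
  which by induction is on the same level as the lower one; this is impossible.
\<close>

lemma psi_same_level:
  assumes st: "same_level S s t" and x: "(s, x) \<in> S" shows "same_level S x (\<psi> s t x)"
  using x
proof (induction x rule: wf_induct_rule[OF wf_underS])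
  case (1 x)
  have IH: "\<And>v. v \<in> underS S x \<Longrightarrow> (s, v) \<in> S \<Longrightarrow> same_level S v (\<psi> s t v)" using 1(1) by simp
  note sx = 1(2)
  have tx: "(t, \<psi> s t x) \<in> S" by (rule psi_above[OF st sx])
  note F = le_FieldD[OF sx] le_FieldD[OF tx]
  consider "ht S x =o ht S (\<psi> s t x)" | "ht S x <o ht S (\<psi> s t x)" | "ht S (\<psi> s t x) <o ht S x"
    using ht_trichotomy by blast
  then show ?case
  proof cases
    case 1 then show ?thesis using F by (simp add: same_level_def)
  next
    case 2
    then obtain w where w: "w \<in> underS S (\<psi> s t x)" "ht S w =o ht S x" using ht_attained_below by blast
    then have xw: "same_level S x w" using F underS_FieldD by (auto simp: same_level_def ordIso_symmetric)
    have tw: "(t, w) \<in> S" by (rule le_transfer[OF st xw sx tx underS_le[OF w(1)]])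
    define v where "v = \<psi> t s w"
    have sv: "(s, v) \<in> S" unfolding v_def by (rule psi_above[OF same_level_sym[OF st] tw])
    have pv: "\<psi> s t v = w" unfolding v_def by (rule psi_inverse[OF same_level_sym[OF st] tw])
    have "v \<in> underS S x" using psi_le_iff[OF st sv sx] pv w(1) by (auto simp: underS_def)
    then show ?thesis using IH[OF _ sv] pv xw same_level_trans same_level_sym same_level_not_underS by metis
  next
    case 3
    then obtain w where w: "w \<in> underS S x" "ht S w =o ht S (\<psi> s t x)" using ht_attained_below by blast
    then have xw: "same_level S (\<psi> s t x) w" using F underS_FieldD by (auto simp: same_level_def ordIso_symmetric)
    have sw: "(s, w) \<in> S" by (rule le_transfer[OF same_level_sym[OF st] xw tx sx underS_le[OF w(1)]])
    have "same_level S (\<psi> s t w) (\<psi> s t x)" using IH[OF w(1) sw] xw same_level_trans same_level_sym by blast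
    then have "\<psi> s t w = \<psi> s t x" using psi_le_iff[OF st sw sx] underS_le[OF w(1)] same_level_le_eq by blast
    then have "w = x" using psi_inverse[OF st] sw sx by metis
    then show ?thesis using w(1) by (simp add: underS_def)
  qed
qed

lemma psi_imm_succ:
  assumes st: "same_level S s t" and x: "x \<in> imm_succs S s" shows "\<psi> s t x \<in> imm_succs S t"
proof -
  have sx: "(s, x) \<in> S" using x imm_succ_underS underS_le by metis
  have l: "same_level S x (\<psi> s t x)" by (rule psi_same_level[OF st sx])
  have "t \<noteq> \<psi> s t x" using l st same_level_trans same_level_sym same_level_not_underS imm_succ_underS[OF x] by metis
  then show ?thesis using imm_succ_same_level[OF x st l] psi_above[OF st sx] underS_I by metis
qed

lemma psi_bij_imm_succs:
  assumes st: "same_level S s t" shows "bij_betw (\<psi> s t) (imm_succs S s) (imm_succs S t)"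
proof -
  have le: "(a, v) \<in> S" if "v \<in> imm_succs S a" for a v using imm_succ_underS[OF that] underS_le by metis
  show ?thesis
    by (rule bij_betw_byWitness[where f' = "\<psi> t s"])
      (auto simp: le psi_inverse[OF st] psi_inverse[OF same_level_sym[OF st]] psi_imm_succ[OF st]
        psi_imm_succ[OF same_level_sym[OF st]])
qed

text \<open>
  Coherence provides one level at which the map of the family takes \<open>t\<close> to \<open>u\<close>; since the maps at higher
  levels are restrictions of it, they do so as well.
\<close>

lemma psi_limit:
  assumes "same_level S t u" "limit_ht S t"
  shows "\<exists>r\<in>underS S t. \<forall>r' s'. (r, r') \<in> S \<and> (r', t) \<in> S \<and> same_level S r' s' \<and> (s', u) \<in> S \<longrightarrow> \<psi> r' s' t = u"
proof -
  obtain \<gamma> :: "'a rel" where g: "\<gamma> <o ht S t"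
    and *: "\<forall>r\<in>underS S t \<inter> level S \<gamma>. \<forall>s\<in>underS S u \<inter> level S \<gamma>. \<psi> r s t = u"
    using coherent assms unfolding coherent_family_def by metis
  obtain r where r: "r \<in> underS S t" "ht S r =o \<gamma>" using ht_attained_below g by blast
  obtain s where s: "s \<in> underS S u" "same_level S r s" using counterpart_below assms(1) r(1) by metis
  have "ht S s =o \<gamma>" using s r unfolding same_level_def using ordIso_symmetric ordIso_transitive by blast
  then have rs: "\<psi> r s t = u" using * r s underS_FieldD by (auto simp: level_def)
  have "\<psi> r' s' t = u" if a: "(r, r') \<in> S" "(r', t) \<in> S" "same_level S r' s'" "(s', u) \<in> S" for r' s'
  proof -
    have "(\<psi> r s r', u) \<in> S" using psi_le_iff[OF s(2) a(1) underS_le[OF r(1)]] a rs by simp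
    moreover have "same_level S (\<psi> r s r') s'" using psi_same_level[OF s(2) a(1)] a same_level_trans same_level_sym by blast
    ultimately have "\<psi> r s r' = s'" using same_level_below_eq a by blast
    then show ?thesis using psi_restrict[OF s(2) a(1,2)] rs by simp
  qed
  then show ?thesis using r by blast
qed

end

section \<open>The equivalence relation\<close>

locale interpolation_quotient = coherent_souslin S \<psi> for S :: "'a rel" and \<psi> +
  fixes n :: nat
  assumes n_pos: "n > 0"
begin

text \<open>
  All nodes of a level share one base node. The choice is made from the set of nodes of the level so
  that it depends on the level only.
\<close>

definition base :: "'a \<Rightarrow> 'a" where
  "base s = (SOME b. b \<in> {b. same_level S s b})"

text \<open>
  The successors of the base node of each level are enumerated by the polynomials of low degree, and
  this labelling is transported along \<open>\<psi>\<close> to all nodes of the level. By the composition law it is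
  then invariant under all the maps \<open>\<psi> s t\<close>.
\<close>

definition label :: "'a \<Rightarrow> 'a \<Rightarrow> rat poly" where
  "label s v = from_nat_into (low_degree n) (to_nat_on (imm_succs S (base s)) (\<psi> s (base s) v))"

definition edge :: "'a \<Rightarrow> 'a \<Rightarrow> rat poly" where
  "edge s t = label s (next_to s t)"

text \<open>
  The index of a chosen representative in an enumeration of its level: this depends on the class
  only, and distinguishes the classes of one level.
\<close>

definition class_code :: "'a set \<Rightarrow> rat" where
  "class_code C = of_nat (to_nat_on {t. same_level S (SOME t. t \<in> C) t} (SOME t. t \<in> C))"

text \<open>
  The recursion for the equivalence class \<open>cls s\<close> of \<open>s\<close>: a node is equivalent to \<open>s\<close> if its
  predecessors are equivalent to those of \<open>s\<close>, and the labels along the two paths always take the same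
  value at the rational assigned to the class that the paths have reached. The evaluation points are
  those of the classes below \<open>s\<close>, so that the recursion is well-founded; that the other path has the
  same ones is part of the proof that this is an equivalence relation.
\<close>

definition class_step :: "('a \<Rightarrow> 'a set) \<Rightarrow> 'a \<Rightarrow> 'a set" where
  "class_step f s = {t. same_level S s t \<and> (\<forall>s'\<in>underS S s. \<forall>t'\<in>underS S t. same_level S s' t' \<longrightarrow>
     t' \<in> f s' \<and> poly (edge s' s) (class_code (f s')) = poly (edge t' t) (class_code (f s')))}"

definition cls :: "'a \<Rightarrow> 'a set" where
  "cls = wfrec {(a, b). a \<in> underS S b} class_step"

definition rep :: "'a \<Rightarrow> 'a" where
  "rep s = (SOME t. t \<in> cls s)"

definition code :: "'a \<Rightarrow> rat" where
  "code s = class_code (cls s)"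

lemma level_set_eq: "same_level S s t \<Longrightarrow> {b. same_level S s b} = {b. same_level S t b}"
  using same_level_trans same_level_sym by blast

lemma same_level_base: "s \<in> Field S \<Longrightarrow> same_level S s (base s)"
  unfolding base_def using someI[of "\<lambda>b. b \<in> {b. same_level S s b}" s] same_level_refl by simp

lemma base_eq: "same_level S s t \<Longrightarrow> base s = base t"
  unfolding base_def using level_set_eq by metis

lemma label_bij:
  assumes "s \<in> Field S" shows "bij_betw (label s) (imm_succs S s) (low_degree n)"
proof -
  let ?b = "base s"
  have b: "same_level S s ?b" by (rule same_level_base[OF assms])
  have "bij_betw (to_nat_on (imm_succs S ?b)) (imm_succs S ?b) UNIV"
    using imm_succs_denumerable same_level_FieldD[OF b] by (simp add: to_nat_on_infinite)
  moreover have "bij_betw (from_nat_into (low_degree n)) UNIV (low_degree n)"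
    by (rule bij_betw_from_nat_into[OF countable_rat_poly infinite_low_degree[OF n_pos]])
  ultimately have "bij_betw (from_nat_into (low_degree n) \<circ> (to_nat_on (imm_succs S ?b) \<circ> \<psi> s ?b))
      (imm_succs S s) (low_degree n)"
    using bij_betw_trans[OF bij_betw_trans[OF psi_bij_imm_succs[OF b]]] by blast
  then show ?thesis by (simp add: label_def comp_def cong: bij_betw_cong)
qed

lemma label_psi:
  assumes st: "same_level S s t" and v: "v \<in> imm_succs S s"
  shows "label t (\<psi> s t v) = label s v"
proof -
  have sv: "(s, v) \<in> S" using v imm_succ_underS underS_le by metis
  have "same_level S t (base s)" using same_level_base same_level_trans same_level_sym st same_level_FieldD by metis
  then show ?thesis using psi_comp[OF st _ sv] base_eq[OF st] by (simp add: label_def)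
qed

lemma cls_unfold: "cls s = class_step cls s"
proof -
  have "adm_wf {(a, b). a \<in> underS S b} class_step"
    by (simp add: adm_wf_def class_step_def)
  then show ?thesis unfolding cls_def using fun_cong[OF wfrec_fixpoint[OF wf_underS]] by blast
qed

lemma cls_iff:
  "t \<in> cls s \<longleftrightarrow> same_level S s t \<and> (\<forall>s'\<in>underS S s. \<forall>t'\<in>underS S t. same_level S s' t' \<longrightarrow>
     t' \<in> cls s' \<and> poly (edge s' s) (code s') = poly (edge t' t) (code s'))"
  by (subst cls_unfold) (simp add: class_step_def code_def)

lemma cls_same_level: "t \<in> cls s \<Longrightarrow> same_level S s t"
  using iffD1[OF cls_iff] by blast

lemma cls_edge:
  assumes "t \<in> cls s" "s' \<in> underS S s" "t' \<in> underS S t" "same_level S s' t'"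
  shows "t' \<in> cls s'" "poly (edge s' s) (code s') = poly (edge t' t) (code s')"
  using iffD1[OF cls_iff assms(1)] assms(2-) by blast+

lemma cls_below:
  assumes "t \<in> cls s" "(s', s) \<in> S" "(t', t) \<in> S" "same_level S s' t'"
  shows "t' \<in> cls s'"
proof (cases "s' = s")
  case True
  then have "t' = t" using assms same_level_trans same_level_sym same_level_le_eq cls_same_level by metis
  then show ?thesis using True assms by simp
next
  case False
  then have "s' \<in> underS S s" using assms underS_I by metis
  moreover have "t' \<in> underS S t"
    using underS_transfer[OF assms(4) cls_same_level[OF assms(1)] calculation assms(3)]
      le_refl le_FieldD assms(3) by metis
  ultimately show ?thesis using cls_edge assms by metis
qed

text \<open>
  Symmetry and transitivity at once. By induction the counterparts below \<open>s\<close> and \<open>t\<close> have the same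
  classes, hence the same evaluation points, so the conditions that define \<open>cls s\<close> and \<open>cls t\<close> are the same.
\<close>

lemma cls_eq: "t \<in> cls s \<Longrightarrow> cls t = cls s"
proof (induction s arbitrary: t rule: wf_induct_rule[OF wf_underS])
  case (1 s)
  have IH: "\<And>s' t'. s' \<in> underS S s \<Longrightarrow> t' \<in> cls s' \<Longrightarrow> cls t' = cls s'" using 1(1) by simp
  note t = 1(2)
  note st = cls_same_level[OF t]
  have code_eq: "code t' = code s'" if "cls t' = cls s'" for s' t' using that by (simp add: code_def)
  have "u \<in> cls s" if u: "u \<in> cls t" for u
    unfolding cls_iff[of u s]
  proof (intro conjI[OF same_level_trans[OF st cls_same_level[OF u]]] ballI impI)
    fix s' u' assume a: "s' \<in> underS S s" "u' \<in> underS S u" "same_level S s' u'"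
    obtain t' where t': "t' \<in> underS S t" "same_level S s' t'" using counterpart_below[OF st a(1)] by blast
    have 1: "t' \<in> cls s'" "poly (edge s' s) (code s') = poly (edge t' t) (code s')" using cls_edge[OF t a(1) t'] by auto
    have e: "cls t' = cls s'" by (rule IH[OF a(1) 1(1)])
    have "same_level S t' u'" using t' a same_level_trans same_level_sym by blast
    from cls_edge[OF u t'(1) a(2) this]
    show "u' \<in> cls s' \<and> poly (edge s' s) (code s') = poly (edge u' u) (code s')"
      using 1 e code_eq[OF e] by simp
  qed
  moreover have "u \<in> cls t" if u: "u \<in> cls s" for u
    unfolding cls_iff[of u t]
  proof (intro conjI[OF same_level_trans[OF same_level_sym[OF st] cls_same_level[OF u]]] ballI impI)
    fix t' u' assume a: "t' \<in> underS S t" "u' \<in> underS S u" "same_level S t' u'"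
    obtain s' where s': "s' \<in> underS S s" "same_level S t' s'" using counterpart_below[OF same_level_sym[OF st] a(1)] by blast
    have 1: "t' \<in> cls s'" "poly (edge s' s) (code s') = poly (edge t' t) (code s')"
      using cls_edge[OF t s'(1) a(1) same_level_sym[OF s'(2)]] by auto
    have e: "cls t' = cls s'" by (rule IH[OF s'(1) 1(1)])
    have "same_level S s' u'" using s' a same_level_trans same_level_sym by blast
    from cls_edge[OF u s'(1) a(2) this]
    show "u' \<in> cls t' \<and> poly (edge t' t) (code t') = poly (edge u' u) (code t')"
      using 1 e code_eq[OF e] by simp
  qed
  ultimately show ?case by blast
qed

lemma cls_refl: "s \<in> Field S \<Longrightarrow> s \<in> cls s"
proof (induction s rule: wf_induct_rule[OF wf_underS])
  case (1 s)
  have "t' = s'" if "s' \<in> underS S s" "t' \<in> underS S s" "same_level S s' t'" for s' t'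
    using that same_level_below_eq underS_le by metis
  then show ?case using 1 same_level_refl underS_FieldD unfolding cls_iff[of s s]
    by (metis (no_types, lifting) case_prodI mem_Collect_eq)
qed

lemma cls_sym: "t \<in> cls s \<Longrightarrow> s \<in> cls t"
  using cls_eq cls_refl cls_same_level same_level_FieldD by metis

lemma rep_in_cls: "s \<in> Field S \<Longrightarrow> rep s \<in> cls s"
  unfolding rep_def using someI[of "\<lambda>t. t \<in> cls s"] cls_refl by blast

lemma rep_eq_iff: "s \<in> Field S \<Longrightarrow> t \<in> Field S \<Longrightarrow> rep s = rep t \<longleftrightarrow> t \<in> cls s"
  using rep_in_cls cls_eq cls_refl cls_sym unfolding rep_def by metis

lemma code_eq_imp_cls:
  assumes "same_level S s t" "code s = code t" shows "t \<in> cls s"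
proof -
  have F: "s \<in> Field S" "t \<in> Field S" using same_level_FieldD[OF assms(1)] by auto
  let ?L = "{u. same_level S s u}"
  have c: "code v = of_nat (to_nat_on ?L (rep v))" "rep v \<in> ?L" if "same_level S s v" for v
  proof -
    have "same_level S s (rep v)"
      using that rep_in_cls cls_same_level same_level_trans same_level_FieldD by metis
    then have "{t. same_level S (rep v) t} = ?L" using level_set_eq by metis
    then show "code v = of_nat (to_nat_on ?L (rep v))" by (simp add: code_def class_code_def rep_def)
    show "rep v \<in> ?L" using \<open>same_level S s (rep v)\<close> by simp
  qed
  have "to_nat_on ?L (rep s) = to_nat_on ?L (rep t)"
    using c[OF same_level_refl[OF F(1)]] c[OF assms(1)] assms(2) by simp
  then have "rep s = rep t"
    using c[OF same_level_refl[OF F(1)]] c[OF assms(1)] countable_same_level by simp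
  then show ?thesis using rep_eq_iff F by blast
qed

text \<open>
  Below \<open>s\<close> and \<open>t\<close> this is part of their equivalence; above them, \<open>\<psi>\<close> preserves labels, and the
  evaluation points agree since they depend on the class only.
\<close>

lemma cls_psi:
  assumes t: "t \<in> cls s" and x: "(s, x) \<in> S" shows "\<psi> s t x \<in> cls x"
  using x
proof (induction x rule: wf_induct_rule[OF wf_underS])
  case (1 x)
  have IH: "\<And>v. v \<in> underS S x \<Longrightarrow> (s, v) \<in> S \<Longrightarrow> \<psi> s t v \<in> cls v" using 1(1) by simp
  note sx = 1(2)
  note st = cls_same_level[OF t]
  note l = psi_same_level[OF st sx]
  note tx = psi_above[OF st sx]
  show ?case unfolding cls_iff[of "\<psi> s t x" x]
  proof (intro conjI[OF l] ballI impI)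
    fix x' y' assume a: "x' \<in> underS S x" "y' \<in> underS S (\<psi> s t x)" "same_level S x' y'"
    show "y' \<in> cls x' \<and> poly (edge x' x) (code x') = poly (edge y' (\<psi> s t x)) (code x')"
    proof (cases "(s, x') \<in> S")
      case True
      have "(\<psi> s t x', \<psi> s t x) \<in> S" using psi_le_iff[OF st True sx] underS_le[OF a(1)] by blast
      moreover have "same_level S (\<psi> s t x') y'" using psi_same_level[OF st True] a(3) same_level_trans same_level_sym by blast
      ultimately have y': "y' = \<psi> s t x'" using same_level_below_eq a(2) underS_le by metis
      let ?v = "next_to x' x"
      have v: "?v \<in> imm_succs S x'" "(?v, x) \<in> S" using next_to[OF a(1)] by auto
      have xv: "(x', ?v) \<in> S" using imm_succ_underS[OF v(1)] underS_le by metis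
      have sv: "(s, ?v) \<in> S" using True xv le_trans by blast
      have pv: "\<psi> x' y' ?v = \<psi> s t ?v" unfolding y' by (rule psi_restrict[OF st True xv])
      have "\<psi> x' y' ?v \<in> imm_succs S y'" by (rule psi_imm_succ[OF a(3) v(1)])
      moreover have "(\<psi> x' y' ?v, \<psi> s t x) \<in> S" using psi_le_iff[OF st sv sx] v(2) pv by simp
      ultimately have "next_to y' (\<psi> s t x) = \<psi> x' y' ?v" by (rule next_to_eq)
      then have "edge y' (\<psi> s t x) = edge x' x" using label_psi[OF a(3) v(1)] by (simp add: edge_def)
      then show ?thesis using IH[OF a(1) True] y' by simp
    next
      case False
      then have xs: "x' \<in> underS S s" using comparable[OF underS_le[OF a(1)] sx] underS_I le_refl le_FieldD sx by metis
      have yt: "y' \<in> underS S t" by (rule underS_transfer[OF a(3) st xs underS_le[OF a(2)] tx])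
      show ?thesis using cls_edge[OF t xs yt a(3)] next_to_le[OF xs sx] next_to_le[OF yt tx] by (simp add: edge_def)
    qed
  qed
qed

text \<open>
  One step above equivalent nodes only the last label matters, because the remaining labels have
  been compared for \<open>s\<close> and \<open>t\<close> already.
\<close>

lemma cls_imm_succ:
  assumes t: "t \<in> cls s" and v: "v \<in> imm_succs S s" and w: "w \<in> imm_succs S t"
  shows "w \<in> cls v \<longleftrightarrow> poly (label s v) (code s) = poly (label t w) (code s)"
proof -
  note st = cls_same_level[OF t]
  note sv = imm_succ_underS[OF v] and tw = imm_succ_underS[OF w]
  have e: "edge s v = label s v" "edge t w = label t w"
    using next_to_eq[OF v] next_to_eq[OF w] le_refl underS_FieldD sv tw by (metis edge_def)+
  note l = imm_succs_same_level[OF st v w]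
  show ?thesis
  proof
    assume "w \<in> cls v"
    from cls_edge(2)[OF this sv tw st] show "poly (label s v) (code s) = poly (label t w) (code s)" using e by simp
  next
    assume p: "poly (label s v) (code s) = poly (label t w) (code s)"
    show "w \<in> cls v" unfolding cls_iff[of w v]
    proof (intro conjI[OF l] ballI impI)
      fix s' t' assume a: "s' \<in> underS S v" "t' \<in> underS S w" "same_level S s' t'"
      show "t' \<in> cls s' \<and> poly (edge s' v) (code s') = poly (edge t' w) (code s')"
      proof (cases "s' = s")
        case True
        then have "t' = t" using same_level_below_eq a st tw underS_le same_level_trans same_level_sym by metis
        then show ?thesis using True t p e by simp
      next
        case False
        then have s': "s' \<in> underS S s" using below_imm_succ[OF v a(1)] underS_I by metis
        have t': "t' \<in> underS S t" by (rule underS_transfer[OF a(3) st s' underS_le[OF a(2)] underS_le[OF tw]])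
        show ?thesis using cls_edge[OF t s' t' a(3)] next_to_le[OF s' underS_le[OF sv]] next_to_le[OF t' underS_le[OF tw]]
          by (simp add: edge_def)
      qed
    qed
  qed
qed

lemma next_to_limit:
  assumes "limit_ht S t" "s \<in> underS S t" shows "next_to s t \<in> underS S t"
proof -
  obtain c where c: "c \<in> underS S t" "s \<in> underS S c" using assms by (auto simp: limit_ht_def)
  then have "next_to s t = next_to s c" using next_to_le underS_le by metis
  then show ?thesis using next_to(2)[OF c(2)] c(1) le_underS_trans by metis
qed

text \<open>
  On limit levels equivalence is decided by the predecessors: each label on the path to \<open>s\<close> already
  occurs on the path to some predecessor of \<open>s\<close>.
\<close>

lemma cls_limit:
  assumes lim: "limit_ht S s" and st: "same_level S s t"
    and below: "\<And>s' t'. s' \<in> underS S s \<Longrightarrow> t' \<in> underS S t \<Longrightarrow> same_level S s' t' \<Longrightarrow> t' \<in> cls s'"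
  shows "t \<in> cls s"
  unfolding cls_iff[of t s]
proof (intro conjI[OF st] ballI impI)
  fix s' t' assume a: "s' \<in> underS S s" "t' \<in> underS S t" "same_level S s' t'"
  have t': "t' \<in> cls s'" by (rule below[OF a])
  note v = next_to(1)[OF a(1)] and w = next_to(1)[OF a(2)]
  have "next_to t' t \<in> cls (next_to s' s)"
    by (rule below[OF next_to_limit[OF lim a(1)] next_to_limit[OF limit_ht_same_level[OF st lim] a(2)]
          imm_succs_same_level[OF a(3) v w]])
  then show "t' \<in> cls s' \<and> poly (edge s' s) (code s') = poly (edge t' t) (code s')"
    using cls_imm_succ[OF t' v w] t' by (simp add: edge_def)
qed

section \<open>Independence of the quotient map on different cones\<close>

lemma chain_upper_bound:
  assumes "finite R" "\<And>a. a \<in> R \<Longrightarrow> a \<in> underS S t" "r \<in> underS S t"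
  shows "\<exists>b\<in>underS S t. (r, b) \<in> S \<and> (\<forall>a\<in>R. (a, b) \<in> S)"
  using assms
proof (induction R rule: finite_induct)
  case empty then show ?case using le_refl underS_FieldD by blast
next
  case (insert x R)
  then obtain b where b: "b \<in> underS S t" "(r, b) \<in> S" "\<forall>a\<in>R. (a, b) \<in> S" by auto
  have x: "x \<in> underS S t" using insert by blast
  have F: "(x, x) \<in> S" "(b, b) \<in> S" using x b le_refl underS_FieldD by metis+
  from comparable[OF underS_le[OF x] underS_le[OF b(1)]]
  show ?case
  proof
    assume "(x, b) \<in> S" then show ?thesis using b by blast
  next
    assume xb: "(b, x) \<in> S"
    have "(r, x) \<in> S \<and> (\<forall>a\<in>insert x R. (a, x) \<in> S)" using b xb F le_trans by blast
    then show ?thesis using x by blast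
  qed
qed

text \<open>
  The nodes above \<open>s\<close> serve as common coordinates for the cones of all \<open>a \<in> A\<close>, through the maps \<open>\<psi> s a\<close>.
\<close>

context
  fixes A :: "'a set" and s :: 'a
  assumes finite_A: "finite A" and A_level: "\<And>a. a \<in> A \<Longrightarrow> same_level S s a"
    and A_indep: "\<And>a b. a \<in> A \<Longrightarrow> b \<in> A \<Longrightarrow> b \<in> cls a \<Longrightarrow> a = b"
begin

text \<open>
  Inequivalent nodes stay inequivalent further up, so that nodes above different elements of \<open>A\<close>
  have different interpolation points.
\<close>

lemma code_inj_above:
  assumes le: "\<And>a. a \<in> A \<Longrightarrow> (a, w a) \<in> S" and l: "\<And>a b. a \<in> A \<Longrightarrow> b \<in> A \<Longrightarrow> same_level S (w a) (w b)"
  shows "inj_on (\<lambda>a. code (w a)) A"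
proof (rule inj_onI)
  fix a b assume a: "a \<in> A" "b \<in> A" "code (w a) = code (w b)"
  have "w b \<in> cls (w a)" using code_eq_imp_cls l a by blast
  moreover have "same_level S a b" using A_level a same_level_trans same_level_sym by blast
  ultimately have "b \<in> cls a" using cls_below le a by blast
  then show "a = b" using A_indep a by blast
qed

text \<open>
  The nodes \<open>b a\<close> are the \<open>u a\<close> cut down to the level of \<open>r\<close>.
\<close>

lemma counterparts:
  assumes a0: "a0 \<in> A" and le: "\<And>a. a \<in> A \<Longrightarrow> (a, u a) \<in> S"
    and l: "\<And>a b. a \<in> A \<Longrightarrow> b \<in> A \<Longrightarrow> same_level S (u a) (u b)"
    and r: "r \<in> underS S (u a0)" "(a0, r) \<in> S"
  obtains b where "b a0 = r" "\<And>a. a \<in> A \<Longrightarrow> b a \<in> underS S (u a)" "\<And>a. a \<in> A \<Longrightarrow> (a, b a) \<in> S"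
    "\<And>a. a \<in> A \<Longrightarrow> same_level S r (b a)" "\<And>a a'. a \<in> A \<Longrightarrow> a' \<in> A \<Longrightarrow> same_level S (b a) (b a')"
proof -
  have "\<forall>a\<in>A. \<exists>c. c \<in> underS S (u a) \<and> same_level S r c"
    using counterpart_below[OF l[OF a0] r(1)] by blast
  then obtain b where b: "\<And>a. a \<in> A \<Longrightarrow> b a \<in> underS S (u a)" "\<And>a. a \<in> A \<Longrightarrow> same_level S r (b a)"
    by metis
  have 1: "b a0 = r" using same_level_below_eq[OF b(2)[OF a0] underS_le[OF r(1)] underS_le[OF b(1)[OF a0]]] by simp
  have 2: "(a, b a) \<in> S" if a: "a \<in> A" for a
  proof -
    have "same_level S a0 a" by (rule same_level_trans[OF same_level_sym[OF A_level[OF a0]] A_level[OF a]])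
    then show ?thesis by (rule le_transfer[OF _ b(2)[OF a] r(2) le[OF a] underS_le[OF b(1)[OF a]]])
  qed
  have 3: "same_level S (b a) (b a')" if "a \<in> A" "a' \<in> A" for a a'
    by (rule same_level_trans[OF same_level_sym[OF b(2)[OF that(1)]] b(2)[OF that(2)]])
  show ?thesis by (rule that[OF 1 b(1) 2 b(2) 3])
qed

text \<open>
  Induction on the level of the nodes \<open>u a\<close>. At a successor, one label \<open>p\<close> must take prescribed values at
  the codes of the at most \<open>n\<close> inequivalent nodes reached so far, which is an interpolation problem.
  At a limit, coherence gives a lower level above which all the \<open>u a\<close> correspond to each other under \<open>\<psi>\<close>;
  the solution on that level, extended by the copy of any one of them, is a solution because
  equivalent nodes have equivalent copies of everything above.
\<close>

lemma joint_surjectivity: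
  assumes card: "card A \<le> n" and a0: "a0 \<in> A" and le: "\<And>a. a \<in> A \<Longrightarrow> (a, u a) \<in> S"
    and l: "\<And>a b. a \<in> A \<Longrightarrow> b \<in> A \<Longrightarrow> same_level S (u a) (u b)"
  shows "\<exists>t. (s, t) \<in> S \<and> (\<forall>a\<in>A. \<psi> s a t \<in> cls (u a))"
  using le l
proof (induction "u a0" arbitrary: u rule: wf_induct_rule[OF wf_underS])
  case (1 u)
  note IH = 1(1) and le = 1(2) and l = 1(3)
  have sF: "s \<in> Field S" using A_level[OF a0] same_level_FieldD by blast
  show ?case
  proof (cases "u a0 = a0")
    case True
    have "u a = a" if a: "a \<in> A" for a
    proof -
      have "same_level S a (u a)" using A_level[OF a] A_level[OF a0] l[OF a0 a] True same_level_trans same_level_sym by metis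
      then show ?thesis using same_level_le_eq[OF _ le[OF a]] by simp
    qed
    then have "\<forall>a\<in>A. \<psi> s a s \<in> cls (u a)" using psi_root[OF A_level] cls_refl same_level_FieldD[OF A_level] by simp
    then show ?thesis using le_refl[OF sF] by blast
  next
    case False
    then have au: "a0 \<in> underS S (u a0)" using le[OF a0] underS_I by metis
    have uF: "u a0 \<in> Field S" using underS_FieldD[OF au] by blast
    from root_or_imm_succ_or_limit[OF uF] au
    consider c where "u a0 \<in> imm_succs S c" | "limit_ht S (u a0)" by blast
    then show ?thesis
    proof cases
      case (1 c)
      obtain b where b: "b a0 = c" "\<And>a. a \<in> A \<Longrightarrow> b a \<in> underS S (u a)" "\<And>a. a \<in> A \<Longrightarrow> (a, b a) \<in> S"
        "\<And>a. a \<in> A \<Longrightarrow> same_level S c (b a)" "\<And>a a'. a \<in> A \<Longrightarrow> a' \<in> A \<Longrightarrow> same_level S (b a) (b a')"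
        using counterparts[OF a0 le l imm_succ_underS[OF 1] below_imm_succ[OF 1 au]] by metis
      have ub: "u a \<in> imm_succs S (b a)" if a: "a \<in> A" for a
        by (rule imm_succ_same_level[OF 1 b(4)[OF a] l[OF a0 a] b(2)[OF a]])
      have "(b a0, u a0) \<in> {(a, b). a \<in> underS S b}" using b(2)[OF a0] by simp
      from IH[OF this b(3) b(5)] obtain t' where t': "(s, t') \<in> S" "\<And>a. a \<in> A \<Longrightarrow> \<psi> s a t' \<in> cls (b a)" by blast
      have "inj_on (\<lambda>a. code (b a)) A" by (rule code_inj_above[OF b(3) b(5)])
      from interpolation_exists[OF finite_A this, of "\<lambda>a. poly (label (b a) (u a)) (code (b a))"]
      obtain p where p: "degree p < max 1 (card A)"
        "\<And>a. a \<in> A \<Longrightarrow> poly p (code (b a)) = poly (label (b a) (u a)) (code (b a))" by blast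
      have "p \<in> low_degree n" using p(1) card n_pos by (simp add: low_degree_def)
      moreover have "label t' ` imm_succs S t' = low_degree n"
        using label_bij[OF le_FieldD(2)[OF t'(1)]] by (simp add: bij_betw_def)
      ultimately have "p \<in> label t' ` imm_succs S t'" by simp
      then obtain t where t: "t \<in> imm_succs S t'" "label t' t = p" by blast
      have tt: "(t', t) \<in> S" using imm_succ_underS[OF t(1)] underS_le by metis
      have "\<psi> s a t \<in> cls (u a)" if a: "a \<in> A" for a
      proof -
        let ?v = "\<psi> s a t'"
        have l': "same_level S t' ?v" by (rule psi_same_level[OF A_level[OF a] t'(1)])
        have e: "\<psi> s a t = \<psi> t' ?v t" using psi_restrict[OF A_level[OF a] t'(1) tt] by simp
        have "label ?v (\<psi> t' ?v t) = p" using label_psi[OF l' t(1)] t(2) by simp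
        then show ?thesis unfolding e
          using cls_imm_succ[OF t'(2)[OF a] ub[OF a] psi_imm_succ[OF l' t(1)]] p(2)[OF a] by simp
      qed
      then show ?thesis using t'(1) tt le_trans by blast
    next
      case 2
      have "\<forall>a\<in>A. \<exists>r\<in>underS S (u a0). \<forall>r' s'. (r, r') \<in> S \<and> (r', u a0) \<in> S \<and> same_level S r' s' \<and> (s', u a) \<in> S
          \<longrightarrow> \<psi> r' s' (u a0) = u a"
        using psi_limit[OF l[OF a0] 2] by blast
      then obtain R where R: "\<And>a. a \<in> A \<Longrightarrow> R a \<in> underS S (u a0)"
        "\<And>a r' s'. a \<in> A \<Longrightarrow> (R a, r') \<in> S \<Longrightarrow> (r', u a0) \<in> S \<Longrightarrow> same_level S r' s' \<Longrightarrow> (s', u a) \<in> S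
          \<Longrightarrow> \<psi> r' s' (u a0) = u a" by metis
      \<comment> \<open>A common bound for the finitely many levels that coherence provides, one for each pair.\<close>
      obtain r where r: "r \<in> underS S (u a0)" "(a0, r) \<in> S" "\<And>a. a \<in> A \<Longrightarrow> (R a, r) \<in> S"
        using chain_upper_bound[of "R ` A" "u a0" a0] finite_A R(1) au by blast
      obtain b where b: "b a0 = r" "\<And>a. a \<in> A \<Longrightarrow> b a \<in> underS S (u a)" "\<And>a. a \<in> A \<Longrightarrow> (a, b a) \<in> S"
        "\<And>a. a \<in> A \<Longrightarrow> same_level S r (b a)" "\<And>a a'. a \<in> A \<Longrightarrow> a' \<in> A \<Longrightarrow> same_level S (b a) (b a')"
        using counterparts[OF a0 le l r(1,2)] by metis
      have "(b a0, u a0) \<in> {(a, b). a \<in> underS S b}" using b(2)[OF a0] by simp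
      from IH[OF this b(3) b(5)] obtain t' where t': "(s, t') \<in> S" "\<And>a. a \<in> A \<Longrightarrow> \<psi> s a t' \<in> cls (b a)" by blast
      have lv: "same_level S (b a) (\<psi> s a t')" if a: "a \<in> A" for a by (rule cls_same_level[OF t'(2)[OF a]])
      have rt: "same_level S r t'"
        using b(1) lv[OF a0] psi_same_level[OF A_level[OF a0] t'(1)] same_level_trans same_level_sym by metis
      have ru: "(r, u a0) \<in> S" by (rule underS_le[OF r(1)])
      define t where "t = \<psi> r t' (u a0)"
      have tt: "(t', t) \<in> S" unfolding t_def by (rule psi_above[OF rt ru])
      have "\<psi> s a t \<in> cls (u a)" if a: "a \<in> A" for a
      proof -
        let ?v = "\<psi> s a t'"
        have tv: "same_level S t' ?v" by (rule psi_same_level[OF A_level[OF a] t'(1)])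
        have "\<psi> s a t = \<psi> t' ?v t" using psi_restrict[OF A_level[OF a] t'(1) tt] by simp
        also have "\<dots> = \<psi> r ?v (u a0)" unfolding t_def by (rule psi_comp[OF rt tv ru])
        also have "\<dots> = \<psi> (b a) ?v (\<psi> r (b a) (u a0))" using psi_comp[OF b(4)[OF a] lv[OF a] ru] by simp
        also have "\<psi> r (b a) (u a0) = u a"
          by (rule R(2)[OF a r(3)[OF a] ru b(4)[OF a] underS_le[OF b(2)[OF a]]])
        finally show ?thesis using cls_psi[OF t'(2)[OF a] underS_le[OF b(2)[OF a]]] by simp
      qed
      then show ?thesis using t'(1) tt le_trans by blast
    qed
  qed
qed

text \<open>
  Induction on \<open>t\<close>. At a successor the labels of \<open>t\<close> and \<open>t'\<close> are polynomials of degree less than \<open>n\<close>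
  that agree at \<open>n\<close> points; at a limit, the predecessors of \<open>t\<close> and \<open>t'\<close> are the same by
  induction, and normality of \<open>S\<close> applies.
\<close>

lemma joint_injectivity:
  assumes card: "card A = n" and st: "(s, t) \<in> S" "(s, t') \<in> S" and l: "same_level S t t'"
    and eq: "\<And>a. a \<in> A \<Longrightarrow> \<psi> s a t' \<in> cls (\<psi> s a t)"
  shows "t = t'"
  using st l eq
proof (induction t arbitrary: t' rule: wf_induct_rule[OF wf_underS])
  case (1 t)
  note st = 1(2) and st' = 1(3) and l = 1(4) and eq = 1(5)
  have sF: "s \<in> Field S" "t \<in> Field S" using le_FieldD[OF st] by auto
  have below: "c = c'" if c: "c \<in> underS S t" "(s, c) \<in> S" "c' \<in> underS S t'" "same_level S c c'" for c c'
  proof -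
    have sc': "(s, c') \<in> S"
      by (rule le_transfer[OF same_level_refl[OF sF(1)] c(4) c(2) st' underS_le[OF c(3)]])
    have "\<psi> s a c' \<in> cls (\<psi> s a c)" if a: "a \<in> A" for a
    proof (rule cls_below[OF eq[OF a]])
      show "(\<psi> s a c, \<psi> s a t) \<in> S" using psi_le_iff[OF A_level[OF a] c(2) st] underS_le[OF c(1)] by blast
      show "(\<psi> s a c', \<psi> s a t') \<in> S" using psi_le_iff[OF A_level[OF a] sc' st'] underS_le[OF c(3)] by blast
      show "same_level S (\<psi> s a c) (\<psi> s a c')"
        using psi_same_level[OF A_level[OF a] c(2)] psi_same_level[OF A_level[OF a] sc'] c(4)
          same_level_trans same_level_sym by metis
    qed
    then show ?thesis using 1(1)[of c c'] c sc' by simp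
  qed
  show ?case
  proof (cases "t = s")
    case True
    then show ?thesis using same_level_le_eq[OF l] st' by simp
  next
    case False
    then have au: "s \<in> underS S t" using st underS_I by metis
    from root_or_imm_succ_or_limit[OF sF(2)] au
    consider c where "t \<in> imm_succs S c" | "limit_ht S t" by blast
    then show ?thesis
    proof cases
      case (1 c)
      note ct = imm_succ_underS[OF 1]
      have sc: "(s, c) \<in> S" by (rule below_imm_succ[OF 1 au])
      obtain c' where c': "c' \<in> underS S t'" "same_level S c c'" using counterpart_below[OF l ct] by blast
      have "c = c'" by (rule below[OF ct sc c'])
      then have t': "t' \<in> imm_succs S c" using imm_succ_same_level[OF 1 c'(2) l c'(1)] by simp
      let ?v = "\<lambda>a. \<psi> s a c"
      have vl: "same_level S c (?v a)" if a: "a \<in> A" for a by (rule psi_same_level[OF A_level[OF a] sc])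
      have inj: "inj_on (\<lambda>a. code (?v a)) A"
      proof (rule code_inj_above)
        show "(a, ?v a) \<in> S" if "a \<in> A" for a by (rule psi_above[OF A_level[OF that] sc])
        show "same_level S (?v a) (?v b)" if "a \<in> A" "b \<in> A" for a b
          using vl[OF that(1)] vl[OF that(2)] same_level_trans same_level_sym by blast
      qed
      have low: "degree (label c t) < n" "degree (label c t') < n"
        using label_bij[of c] le_FieldD[OF sc] 1 t' by (auto simp: bij_betw_def low_degree_def)
      have "poly (label c t) (code (?v a)) = poly (label c t') (code (?v a))" if a: "a \<in> A" for a
      proof -
        have e: "\<psi> s a x = \<psi> c (?v a) x" if "x \<in> imm_succs S c" for x
          using psi_restrict[OF A_level[OF a] sc] imm_succ_underS[OF that] underS_le by metis
        have "?v a \<in> cls (?v a)" using cls_refl vl[OF a] same_level_FieldD by blast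
        from cls_imm_succ[OF this psi_imm_succ[OF vl[OF a] 1] psi_imm_succ[OF vl[OF a] t']]
        show ?thesis using eq[OF a] e[OF 1] e[OF t'] label_psi[OF vl[OF a] 1] label_psi[OF vl[OF a] t'] by simp
      qed
      then have "label c t = label c t'"
        using poly_eqI_degree[of "(\<lambda>a. code (?v a)) ` A" "label c t" "label c t'"] low card card_image[OF inj] by auto
      then show ?thesis using label_bij[of c] le_FieldD[OF sc] 1 t' by (auto simp: bij_betw_def inj_on_def)
    next
      case 2
      have aux: "c \<in> underS S t'" if c: "c \<in> underS S t" for c
      proof -
        obtain d where d: "d \<in> underS S t" "(s, d) \<in> S" "(c, d) \<in> S"
          using chain_upper_bound[of "{c}" t s] c au by auto
        obtain d' where d': "d' \<in> underS S t'" "same_level S d d'" using counterpart_below[OF l d(1)] by blast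
        show ?thesis using below[OF d(1,2) d'] d d' le_underS_trans by blast
      qed
      moreover have "c' \<in> underS S t" if c': "c' \<in> underS S t'" for c'
      proof -
        obtain c where c: "c \<in> underS S t" "same_level S c' c"
          using counterpart_below[OF same_level_sym[OF l] c'] by blast
        then show ?thesis using same_level_below_eq aux c' underS_le by metis
      qed
      ultimately have "underS S t = underS S t'" by blast
      then show ?thesis using souslin 2 l unfolding souslin_tree_def normal_tree_def same_level_def by blast
    qed
  qed
qed

end

end

section \<open>The quotient tree\<close>

context interpolation_quotient
begin

text \<open>
  The quotient tree lives on a set of representatives, hence on the type of \<open>S\<close>.
\<close>

definition T :: "'a rel" where
  "T = dir_image S rep"

lemma Field_T: "Field T = rep ` Field S"
  by (simp add: T_def dir_image_Field)

lemma rep_Field: "s \<in> Field S \<Longrightarrow> rep s \<in> Field S"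
  using rep_in_cls cls_same_level same_level_FieldD by metis

lemma rep_rep: assumes "x \<in> Field T" shows "rep x = x"
proof -
  obtain s where s: "s \<in> Field S" "x = rep s" using assms Field_T by auto
  then show ?thesis using rep_eq_iff[OF s(1) rep_Field[OF s(1)]] rep_in_cls by simp
qed

lemma Field_T_subset: "x \<in> Field T \<Longrightarrow> x \<in> Field S"
  using Field_T rep_Field by auto

lemma T_repI: "(s, t) \<in> S \<Longrightarrow> (rep s, rep t) \<in> T"
  unfolding T_def dir_image_def by blast

lemma T_lift_down:
  assumes "(rep s, rep t) \<in> T" "s \<in> Field S" "t \<in> Field S"
  shows "\<exists>s'. (s', t) \<in> S \<and> s' \<in> cls s"
proof -
  obtain s0 t0 where 0: "(s0, t0) \<in> S" "rep s = rep s0" "rep t = rep t0"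
    using assms by (auto simp: T_def dir_image_def)
  have s0: "s0 \<in> cls s" using rep_eq_iff[OF assms(2) le_FieldD(1)[OF 0(1)]] 0(2) by blast
  have t0: "t \<in> cls t0" using rep_eq_iff[OF le_FieldD(2)[OF 0(1)] assms(3)] 0(3) by simp
  obtain s' where s': "(s', t) \<in> S" "same_level S s0 s'"
    using counterpart_below_eq[OF cls_same_level[OF t0] 0(1)] by blast
  have "s' \<in> cls s0" by (rule cls_below[OF t0 0(1) s'])
  then show ?thesis using s'(1) cls_eq[OF s0] by blast
qed

text \<open>
  The representative \<open>x\<close> need not be the node of its class over which \<open>y\<close> was found; the map \<open>\<psi>\<close>
  moves the configuration there.
\<close>

lemma T_lift_up:
  assumes "(x, y) \<in> T" shows "\<exists>v. (x, v) \<in> S \<and> rep v = y"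
proof -
  obtain s t where st: "(s, t) \<in> S" "x = rep s" "y = rep t"
    using assms by (auto simp: T_def dir_image_def)
  have x: "x \<in> cls s" using rep_in_cls[OF le_FieldD(1)[OF st(1)]] st(2) by simp
  have le: "(x, \<psi> s x t) \<in> S" by (rule psi_above[OF cls_same_level[OF x] st(1)])
  have "rep (\<psi> s x t) = y"
    using rep_eq_iff[OF le_FieldD(2)[OF st(1)] le_FieldD(2)[OF le]] cls_psi[OF x st(1)] st(3) by simp
  then show ?thesis using le by blast
qed

lemma T_le_rep_iff:
  assumes "(a, t) \<in> S" "(b, t) \<in> S" shows "(a, b) \<in> S \<longleftrightarrow> (rep a, rep b) \<in> T"
proof
  assume "(rep a, rep b) \<in> T"
  then obtain a' where a': "(a', b) \<in> S" "a' \<in> cls a"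
    using T_lift_down le_FieldD[OF assms(1)] le_FieldD[OF assms(2)] by blast
  have "a = a'" using same_level_below_eq[OF cls_same_level[OF a'(2)] assms(1)] le_trans[OF a'(1) assms(2)] by simp
  then show "(a, b) \<in> S" using a' by simp
qed (rule T_repI)

lemma rep_inj_below: "(a, t) \<in> S \<Longrightarrow> (b, t) \<in> S \<Longrightarrow> rep a = rep b \<Longrightarrow> a = b"
  using rep_eq_iff le_FieldD cls_same_level same_level_below_eq by metis

text \<open>
  The predecessors of a node lie on different levels, hence in different classes; so the quotient
  map preserves heights.
\<close>

lemma rep_bij_underS:
  assumes "t \<in> Field S" shows "bij_betw rep (underS S t) (underS T (rep t))"
proof (rule bij_betwI')
  fix x y assume "x \<in> underS S t" "y \<in> underS S t"
  then show "rep x = rep y \<longleftrightarrow> x = y" using rep_inj_below underS_le by metis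
next
  fix x assume x: "x \<in> underS S t"
  have "rep x \<noteq> rep t" using rep_inj_below[OF underS_le[OF x] le_refl[OF assms]] underS_ne[OF x] by blast
  then show "rep x \<in> underS T (rep t)" using T_repI[OF underS_le[OF x]] by (rule underS_I[rotated])
next
  fix y assume y: "y \<in> underS T (rep t)"
  then have "y \<in> Field T" by (auto simp: underS_def Field_def)
  then obtain s where s: "s \<in> Field S" "y = rep s" using Field_T by auto
  obtain s' where s': "(s', t) \<in> S" "s' \<in> cls s" using T_lift_down underS_le[OF y] s assms by blast
  have "rep s' = y" using rep_eq_iff[OF s(1) le_FieldD(1)[OF s'(1)]] s' s by simp
  moreover have "s' \<noteq> t" using \<open>rep s' = y\<close> underS_ne[OF y] by blast
  ultimately show "\<exists>x\<in>underS S t. y = rep x" using s'(1) underS_I by metis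
qed

lemma ht_T_rep:
  assumes "t \<in> Field S" shows "Well_order (ht T (rep t))" "ht S t =o ht T (rep t)"
proof -
  have "Well_order (Restr S (underS S t))" using Well_order_ht[of t] by (simp add: ht_def)
  note * = order_isomorphic_Restr[OF this _ rep_bij_underS[OF assms]]
  show "Well_order (ht T (rep t))" unfolding ht_def
    by (rule *(1)) (use le_refl underS_FieldD T_le_rep_iff underS_le in metis)+
  show "ht S t =o ht T (rep t)" unfolding ht_def
    by (rule *(2)) (use le_refl underS_FieldD T_le_rep_iff underS_le in metis)+
qed

lemma is_tree_T: "is_tree T"
proof -
  have "refl_on (Field T) T"
    unfolding refl_on_def using T_repI le_refl by (auto simp: Field_T)
  moreover have "trans T"
  proof (rule transI)
    fix x y z assume a: "(x, y) \<in> T" "(y, z) \<in> T"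
    obtain v where v: "(x, v) \<in> S" "rep v = y" using T_lift_up[OF a(1)] by blast
    obtain w where w: "(y, w) \<in> S" "rep w = z" using T_lift_up[OF a(2)] by blast
    have y: "y \<in> cls v" using rep_in_cls[OF le_FieldD(2)[OF v(1)]] v(2) by simp
    have F: "x \<in> Field T" "y \<in> Field T" using a by (auto simp: Field_def)
    obtain x' where x': "(x', y) \<in> S" "x' \<in> cls x"
      using T_lift_down[of x y] a(1) rep_rep F Field_T_subset by metis
    have "rep x' = x" using rep_eq_iff x'(2) rep_rep[OF F(1)] cls_same_level same_level_FieldD by metis
    then show "(x, z) \<in> T" using T_repI[OF le_trans[OF x'(1) w(1)]] w(2) by simp
  qed
  moreover have "antisym T"
  proof (rule antisymI)
    fix x y assume a: "(x, y) \<in> T" "(y, x) \<in> T"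
    have F: "x \<in> Field T" "y \<in> Field T" using a by (auto simp: Field_def)
    have SF: "x \<in> Field S" "y \<in> Field S" using F Field_T_subset by auto
    have r: "rep x = x" "rep y = y" using F rep_rep by auto
    obtain x' where x': "(x', y) \<in> S" "x' \<in> cls x" using T_lift_down[OF _ SF] a r by auto
    obtain y' where y': "(y', x) \<in> S" "y' \<in> cls y" using T_lift_down[OF _ SF(2,1)] a r by auto
    obtain y'' where y'': "(y'', x') \<in> S" "same_level S y' y''"
      using counterpart_below_eq[OF cls_same_level[OF x'(2)] y'(1)] by blast
    have "same_level S y'' y" using y''(2) cls_same_level[OF y'(2)] same_level_trans same_level_sym by blast
    then have "y'' = y" using same_level_le_eq le_trans[OF y''(1) x'(1)] by blast
    then have "x' = y" using y''(1) x'(1) le_antisym by blast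
    then show "x = y" using rep_eq_iff[OF SF] x'(2) r by simp
  qed
  moreover have "Well_order (Restr T (underS T x))" if "x \<in> Field T" for x
  proof -
    obtain s where "s \<in> Field S" "x = rep s" using \<open>x \<in> Field T\<close> Field_T by auto
    then show ?thesis using ht_T_rep(1)[of s] by (simp add: ht_def)
  qed
  ultimately show ?thesis by (auto simp: is_tree_def partial_order_on_def preorder_on_def
        intro: Field_def[THEN equalityD2, THEN subsetD] FieldI1 FieldI2)
qed

sublocale T: tree T
  by (rule tree.intro[OF is_tree_T])

lemma same_level_T_rep: 
  assumes "s \<in> Field S" "t \<in> Field S" shows "same_level T (rep s) (rep t) \<longleftrightarrow> same_level S s t"
proof -
  have "ht T (rep s) =o ht T (rep t) \<longleftrightarrow> ht S s =o ht S t"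
    using ht_T_rep(2) assms ordIso_transitive ordIso_symmetric by metis
  then show ?thesis using assms Field_T by (auto simp: same_level_def)
qed

lemma same_level_T: "x \<in> Field T \<Longrightarrow> y \<in> Field T \<Longrightarrow> same_level T x y \<longleftrightarrow> same_level S x y"
  using same_level_T_rep rep_rep Field_T_subset by metis

lemma level_T: "level T \<alpha> = rep ` level S \<alpha>"
proof -
  have "ht T (rep s) =o \<alpha> \<longleftrightarrow> ht S s =o \<alpha>" if "s \<in> Field S" for s
    using ht_T_rep(2)[OF that] ordIso_transitive ordIso_symmetric by metis
  then show ?thesis by (auto simp: level_def Field_T)
qed

lemma underS_T: "x \<in> Field T \<Longrightarrow> underS T x = rep ` underS S x"
  using rep_bij_underS[of x] rep_rep Field_T_subset by (simp add: bij_betw_def)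

lemma imm_succs_T:
  assumes v: "v \<in> imm_succs S s" shows "rep v \<in> imm_succs T (rep s)"
proof -
  note sv = imm_succ_underS[OF v]
  have vF: "v \<in> Field S" using underS_FieldD[OF sv] by simp
  have *: "underS T (rep v) = rep ` underS S v" using rep_bij_underS[OF vF] by (simp add: bij_betw_def)
  have "rep s \<in> underS T (rep v)" using * sv by blast
  moreover have False if u: "rep s \<in> underS T u" "u \<in> underS T (rep v)" for u
  proof -
    obtain w where w: "w \<in> underS S v" "u = rep w" using u(2) * by auto
    have "(w, s) \<in> S" by (rule below_imm_succ[OF v w(1)])
    then have "(u, rep s) \<in> T" using T_repI w(2) by simp
    then show False using u(1) T.le_antisym by (auto simp: underS_def)
  qed
  ultimately show ?thesis using vF Field_T by (auto simp: imm_succs_def)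
qed

text \<open>
  The successors of \<open>x\<close> that are labelled by constant polynomials are pairwise inequivalent.
\<close>

lemma infinite_imm_succs_T: assumes "x \<in> Field T" shows "infinite (imm_succs T x)"
proof -
  have xS: "x \<in> Field S" by (rule Field_T_subset[OF assms])
  define g where "g = (\<lambda>c::rat. inv_into (imm_succs S x) (label x) [:c:])"
  have im: "label x ` imm_succs S x = low_degree n" using label_bij[OF xS] by (simp add: bij_betw_def)
  have "[:c:] \<in> label x ` imm_succs S x" for c :: rat unfolding im using n_pos by (simp add: low_degree_def)
  then have g: "g c \<in> imm_succs S x" "label x (g c) = [:c:]" for c
    unfolding g_def by (rule inv_into_into, rule f_inv_into_f)
  have "c = d" if e: "rep (g c) = rep (g d)" for c d
  proof -
    have "g d \<in> cls (g c)" using e rep_eq_iff g(1) unfolding imm_succs_def by blast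
    then show ?thesis using cls_imm_succ[OF cls_refl[OF xS] g(1) g(1)] g(2) by simp
  qed
  then have "inj (\<lambda>c. rep (g c))" by (rule injI)
  moreover have "range (\<lambda>c. rep (g c)) \<subseteq> imm_succs T x" using imm_succs_T[OF g(1)] rep_rep[OF assms] by auto
  ultimately show ?thesis using infinite_UNIV_char_0[where 'a = rat] finite_subset finite_imageD by metis
qed

text \<open>
  A set of representatives that is an antichain in the quotient is an antichain in \<open>S\<close>.
\<close>

lemma T_ccc: "ccc T"
  unfolding ccc_def
proof (intro allI impI)
  fix A assume A: "antichain T A"
  have "rep x = x" "x \<in> Field S" if "x \<in> A" for x
    using A that rep_rep Field_T_subset by (auto simp: antichain_def)
  then have "antichain S A" using A T_repI unfolding antichain_def by (metis subsetI)
  then show "countable A" using souslin by (auto simp: souslin_tree_def ccc_def)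
qed

lemma T_countable_imm_succs: "countable (imm_succs T x)"
proof -
  have "(t, u) \<notin> T" if t: "t \<in> imm_succs T x" and u: "u \<in> imm_succs T x" and ne: "t \<noteq> u" for t u
    using t u ne underS_I[of t u T] by (auto simp: imm_succs_def)
  then have "antichain T (imm_succs T x)" unfolding antichain_def by (auto simp: imm_succs_def)
  then show ?thesis using T_ccc by (simp add: ccc_def)
qed

text \<open>
  A branch contains at most one immediate successor of each of its nodes. Choosing for each node an
  immediate successor off the branch yields an antichain, and different nodes have different choices.
\<close>

lemma T_countable_branch: assumes B: "branch T B" shows "countable B"
proof -
  have "\<exists>v. v \<in> imm_succs T b \<and> v \<notin> B" if b: "b \<in> B" for b
  proof -
    have bF: "b \<in> Field T" using B b by (auto simp: branch_def)
    obtain v where v: "v \<in> imm_succs T b" using infinite_imm_succs_T[OF bF] by fastforce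
    obtain w where w: "w \<in> imm_succs T b" "w \<noteq> v" using infinite_imm_succs_T[OF bF] v
      by (metis finite.emptyI finite.insertI finite_subset insertI1 subsetI)
    have "(v, w) \<notin> T \<and> (w, v) \<notin> T" using v w underS_I[of v w T] underS_I[of w v T] by (auto simp: imm_succs_def)
    then show ?thesis using B v w unfolding branch_def by blast
  qed
  then obtain g where g: "\<And>b. b \<in> B \<Longrightarrow> g b \<in> imm_succs T b" "\<And>b. b \<in> B \<Longrightarrow> g b \<notin> B" by metis
  have le: "g b = g c" if b: "b \<in> B" and c: "c \<in> B" and l: "(g b, g c) \<in> T" for b c
  proof (rule ccontr)
    assume "g b \<noteq> g c"
    then have "g b \<in> underS T (g c)" using l by (rule underS_I[rotated])
    then have "(g b, c) \<in> T" by (rule T.below_imm_succ[OF g(1)[OF c]])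
    then have "g b \<in> underS T c" using g(2)[OF b] c underS_I by metis
    then show False using B c g(2)[OF b] unfolding branch_def by blast
  qed
  have "antichain T (g ` B)"
    unfolding antichain_def
  proof (intro conjI ballI impI)
    show "g ` B \<subseteq> Field T" using g(1) by (auto simp: imm_succs_def)
    fix s t assume "s \<in> g ` B" "t \<in> g ` B" "s \<noteq> t"
    then show "(s, t) \<notin> T" using le by (metis imageE)
    show "(t, s) \<notin> T" using le \<open>s \<in> g ` B\<close> \<open>t \<in> g ` B\<close> \<open>s \<noteq> t\<close> by (metis imageE)
  qed
  then have "countable (g ` B)" using T_ccc by (simp add: ccc_def)
  moreover have "inj_on g B"
  proof (rule inj_onI)
    fix b c assume bc: "b \<in> B" "c \<in> B" "g b = g c"
    have "b \<in> underS T (g c)" "c \<in> underS T (g b)" using g(1) bc T.imm_succ_underS by metis+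
    then have "(b, c) \<in> T" "(c, b) \<in> T" using T.below_imm_succ g(1) bc by blast+
    then show "b = c" by (rule T.le_antisym)
  qed
  ultimately show ?thesis by (rule countable_image_inj_on)
qed

lemma T_has_height: "has_height T omega1"
  using souslin unfolding souslin_tree_def has_height_def level_T by simp

lemma limit_ht_T: assumes x: "x \<in> Field T" and "limit_ht T x" shows "limit_ht S x"
proof -
  have "\<exists>c\<in>underS S x. b \<in> underS S c" if b: "b \<in> underS S x" for b
  proof -
    have "rep b \<in> underS T x" using b underS_T[OF x] by blast
    then obtain c' where c': "c' \<in> underS T x" "rep b \<in> underS T c'" using assms(2) by (auto simp: limit_ht_def)
    then obtain c where c: "c \<in> underS S x" "c' = rep c" using underS_T[OF x] by auto
    have "(b, c) \<in> S" using T_le_rep_iff[OF underS_le[OF b] underS_le[OF c(1)]] underS_le[OF c'(2)] c(2) by simp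
    moreover have "b \<noteq> c" using c'(2) c(2) by (auto simp: underS_def)
    ultimately show ?thesis using c(1) underS_I by metis
  qed
  then show ?thesis using assms underS_T[OF x] by (auto simp: limit_ht_def)
qed

lemma T_normal: "normal_tree T omega1"
  unfolding normal_tree_def
proof (intro conjI ballI allI impI)
  show "has_height T omega1" by (rule T_has_height)
next
  have ex: "\<exists>!t. t \<in> Field S \<and> underS S t = {}" using souslin by (simp add: souslin_tree_def normal_tree_def)
  then obtain t where t: "t \<in> Field S" "underS S t = {}" by blast
  show "\<exists>!t. t \<in> Field T \<and> underS T t = {}"
  proof (rule ex1I)
    show "rep t \<in> Field T \<and> underS T (rep t) = {}"
      using t Field_T rep_bij_underS[OF t(1)] by (auto simp: bij_betw_def)
    fix x assume "x \<in> Field T \<and> underS T x = {}"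
    then have "x \<in> Field T" "underS S x = {}" using underS_T by auto
    then show "x = rep t" using ex t rep_rep Field_T_subset by metis
  qed
next
  fix s assume s: "s \<in> Field T"
  obtain v where v: "v \<in> imm_succs T s" using infinite_imm_succs_T[OF s] by fastforce
  obtain w where w: "w \<in> imm_succs T s" "w \<noteq> v" using infinite_imm_succs_T[OF s] v
    by (metis finite.emptyI finite.insertI finite_subset insertI1 subsetI)
  show "\<exists>t\<in>imm_succs T s. \<exists>u\<in>imm_succs T s. t \<noteq> u" using v w by blast
next
  fix s and \<alpha> :: "nat set rel"
  assume s: "s \<in> Field T" and a: "ht T s <o \<alpha> \<and> level T \<alpha> \<noteq> {}"
  have sS: "s \<in> Field S" by (rule Field_T_subset[OF s])
  have "ht S s <o \<alpha>" using ht_T_rep(2)[OF sS] a rep_rep[OF s] ordIso_ordLess_trans by metis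
  moreover have "level S \<alpha> \<noteq> {}" using a level_T by auto
  ultimately obtain t where t: "t \<in> level S \<alpha>" "(s, t) \<in> S"
    using souslin sS unfolding souslin_tree_def normal_tree_def by metis
  then show "\<exists>t\<in>level T \<alpha>. (s, t) \<in> T" using T_repI[OF t(2)] rep_rep[OF s] level_T by auto
next
  fix s t assume s: "s \<in> Field T" and t: "t \<in> Field T"
    and a: "limit_ht T s \<and> ht T s =o ht T t \<and> underS T s = underS T t"
  have l: "same_level S s t" using same_level_T[OF s t] s t a by (simp add: same_level_def)
  have "t \<in> cls s"
  proof (rule cls_limit[OF limit_ht_T[OF s] l])
    fix s' t' assume b: "s' \<in> underS S s" "t' \<in> underS S t" "same_level S s' t'"
    have "rep s' \<in> underS T t" using underS_T[OF s] b(1) a by blast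
    then obtain t'' where t'': "t'' \<in> underS S t" "rep s' = rep t''" using underS_T[OF t] by auto
    have c: "t'' \<in> cls s'" using rep_eq_iff t'' b(1) underS_FieldD by metis
    then have "t'' = t'" using cls_same_level b t''(1) same_level_trans same_level_sym same_level_below_eq underS_le by metis
    then show "t' \<in> cls s'" using c by simp
  qed (use a in simp)
  then show "s = t" using rep_eq_iff Field_T_subset s t rep_rep by metis
qed

lemma T_souslin: "souslin_tree T"
  unfolding souslin_tree_def aleph0_splitting_def
  using is_tree_T T_has_height T_ccc T_countable_branch T_normal T_countable_imm_succs infinite_imm_succs_T by blast

sublocale T: normal_souslin T
  by unfold_locales (rule T_souslin)

section \<open>Freeness\<close>

text \<open>
  By joint surjectivity every node \<open>f\<close> of the product is the tuple of classes determined by a single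
  node \<open>h f\<close> of \<open>S\<close>. If \<open>h f\<close> and \<open>h g\<close> are comparable, then so are \<open>f\<close> and \<open>g\<close>; hence an
  antichain of the product is mapped injectively onto an antichain of \<open>S\<close>.
\<close>

lemma T_product_ccc:
  assumes P: "P \<subseteq> level T \<alpha>" "finite P" "card P = n"
  shows "ccc (tree_product omega1 P (cone T))"
  unfolding ccc_def
proof (intro allI impI)
  fix X assume X: "antichain (tree_product omega1 P (cone T)) X"
  have PT: "a \<in> Field T" if "a \<in> P" for a using that P(1) by (auto simp: level_def)
  have PlT: "same_level T a b" if "a \<in> P" "b \<in> P" for a b
  proof -
    have "a \<in> Field T" "ht T a =o \<alpha>" "b \<in> Field T" "ht T b =o \<alpha>"
      using that P(1) by (auto simp: level_def)
    then show ?thesis unfolding same_level_def using ordIso_transitive[OF _ ordIso_symmetric] by blast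
  qed
  have Pl: "same_level S a b" if "a \<in> P" "b \<in> P" for a b using PlT[OF that] same_level_T PT that by blast
  have ind: "a = b" if "a \<in> P" "b \<in> P" "b \<in> cls a" for a b
    using that PT rep_eq_iff Field_T_subset rep_rep by metis
  obtain a0 where a0: "a0 \<in> P" using P(3) n_pos by fastforce
  have nodes: "f \<in> tree_product_nodes omega1 P (cone T)" if "f \<in> X" for f
    using X that unfolding antichain_def by (auto simp: tree_product_def Field_def)
  have above: "(a, f a) \<in> T" if f: "f \<in> X" and a: "a \<in> P" for f a
  proof -
    have "f a \<in> Field (cone T a)" using nodes[OF f] a by (auto simp: tree_product_nodes_def level_def)
    then show ?thesis using T.Field_cone[OF PT[OF a]] by (simp add: above_def)
  qed
  have lev: "same_level T (f a) (f b)" if f: "f \<in> X" and ab: "a \<in> P" "b \<in> P" for f a b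
  proof -
    obtain \<beta> :: "nat set rel" where "\<forall>a\<in>P. ht (cone T a) (f a) =o \<beta>"
      using nodes[OF f] by (auto simp: tree_product_nodes_def level_def PiE_def)
    then have "ht (cone T a) (f a) =o ht (cone T b) (f b)"
      using ab ordIso_symmetric ordIso_transitive by blast
    then show ?thesis by (rule T.same_level_if_ht_cone[OF PlT[OF ab] above[OF f ab(1)] above[OF f ab(2)]])
  qed
  have "\<exists>t. (a0, t) \<in> S \<and> (\<forall>a\<in>P. rep (\<psi> a0 a t) = f a)" if f: "f \<in> X" for f
  proof -
    have "\<forall>a\<in>P. \<exists>v. (a, v) \<in> S \<and> rep v = f a" using T_lift_up above[OF f] by blast
    then obtain u where u: "\<And>a. a \<in> P \<Longrightarrow> (a, u a) \<in> S" "\<And>a. a \<in> P \<Longrightarrow> rep (u a) = f a" by metis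
    have l: "same_level S (u a) (u b)" if "a \<in> P" "b \<in> P" for a b
      using lev[OF f that] u[OF that(1)] u[OF that(2)] same_level_T_rep le_FieldD by metis
    obtain t where t: "(a0, t) \<in> S" "\<forall>a\<in>P. \<psi> a0 a t \<in> cls (u a)"
      using joint_surjectivity[OF P(2) Pl[OF a0] ind eq_imp_le[OF P(3)] a0 u(1) l] by blast
    have "rep (\<psi> a0 a t) = f a" if a: "a \<in> P" for a
      using t(2) a u rep_eq_iff cls_same_level same_level_FieldD by metis
    then show ?thesis using t(1) by blast
  qed
  then obtain h where h: "\<And>f. f \<in> X \<Longrightarrow> (a0, h f) \<in> S" "\<And>f a. f \<in> X \<Longrightarrow> a \<in> P \<Longrightarrow> rep (\<psi> a0 a (h f)) = f a"
    by metis
  have le: "f = g" if f: "f \<in> X" and g: "g \<in> X" and l: "(h f, h g) \<in> S" for f g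
  proof -
    have "(f a, g a) \<in> cone T a" if a: "a \<in> P" for a
    proof -
      have "(\<psi> a0 a (h f), \<psi> a0 a (h g)) \<in> S" using psi_le_iff[OF Pl[OF a0 a] h(1)[OF f] h(1)[OF g]] l by simp
      from T_repI[OF this] show ?thesis using h(2)[OF f a] h(2)[OF g a] above[OF f a] by (simp add: T.cone_le_iff)
    qed
    then have "(f, g) \<in> tree_product omega1 P (cone T)" using nodes f g by (simp add: tree_product_def)
    then show ?thesis using X f g unfolding antichain_def by blast
  qed
  have "antichain S (h ` X)"
    unfolding antichain_def using le h(1) le_FieldD by blast
  then have "countable (h ` X)" using souslin by (auto simp: souslin_tree_def ccc_def)
  moreover have "inj_on h X"
  proof (rule inj_onI)
    fix f g assume fg: "f \<in> X" "g \<in> X" "h f = h g"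
    then have "(h f, h g) \<in> S" using h(1)[OF fg(2)] le_FieldD le_refl by metis
    then show "f = g" using le fg by blast
  qed
  ultimately show "countable X" by (rule countable_image_inj_on)
qed

lemma T_n_free: "n_free n T"
  unfolding n_free_def using T_souslin T_product_ccc by blast

end

section \<open>The automorphism added by generic branches\<close>

context interpolation_quotient
begin

text \<open>
  The nodes \<open>x i\<close> with \<open>i < k\<close> form the condition that is going to force a nontrivial automorphism, and the
  cones of \<open>x k\<close> and \<open>x (Suc k)\<close> are the ones that it exchanges.
\<close>

context
  fixes k :: nat and x :: "nat \<Rightarrow> 'a" and stem :: 'a
  assumes n_eq: "n = Suc k" and inj_x: "inj x" and x_imm: "\<And>i. x i \<in> imm_succs T stem"
begin

text \<open>
  The nodes of \<open>S\<close> above \<open>x 0\<close> serve as common coordinates for the cones of all \<open>x i\<close>: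
  \<open>branch_at i t\<close> is the node above \<open>x i\<close> with coordinate \<open>t\<close>.
\<close>

definition branch_at :: "nat \<Rightarrow> 'a \<Rightarrow> 'a" where
  "branch_at i t = rep (\<psi> (x 0) (x i) t)"

text \<open>
  The condition \<open>q\<close> decides the image \<open>z\<close> above \<open>x e\<close> of the node \<open>y\<close> above \<open>x d\<close>: they
  have a common coordinate \<open>t\<close>, and \<open>q\<close> decides the generic branches up to the level of \<open>t\<close> in
  accordance with this coordinate.
\<close>

definition moves :: "nat \<Rightarrow> nat \<Rightarrow> (nat \<Rightarrow> 'a) \<Rightarrow> 'a \<Rightarrow> 'a \<Rightarrow> bool" where
  "moves d e q y z \<longleftrightarrow> (\<exists>t. (x 0, t) \<in> S \<and> (\<forall>i<k. (branch_at i t, q i) \<in> T) \<and>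
     y = branch_at d t \<and> z = branch_at e t)"

definition swaps :: "(nat \<Rightarrow> 'a) \<Rightarrow> 'a \<Rightarrow> 'a \<Rightarrow> bool" where
  "swaps q y z \<longleftrightarrow> (y = z \<and> y \<in> Field T \<and> (x k, y) \<notin> T \<and> (x (Suc k), y) \<notin> T) \<or>
     moves k (Suc k) q y z \<or> moves (Suc k) k q y z"

lemma x_Field: "x i \<in> Field T" "x i \<in> Field S"
  using x_imm[of i] Field_T_subset by (auto simp: imm_succs_def)

lemma x_level_T: "same_level T (x i) (x j)"
  using T.imm_succs_same_level[OF T.same_level_refl x_imm x_imm] T.imm_succ_underS[OF x_imm] T.underS_FieldD by blast

lemma x_level: "same_level S (x i) (x j)"
  using x_level_T same_level_T x_Field by blast

lemma x_indep: "x j \<in> cls (x i) \<Longrightarrow> x i = x j"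
  using rep_eq_iff x_Field rep_rep by metis

lemma x_disjoint: "(x i, y) \<in> T \<Longrightarrow> (x j, y) \<in> T \<Longrightarrow> i = j"
  using T.same_level_below_eq[OF x_level_T] inj_x by (metis injD)

lemma branch_at_above: "(x 0, t) \<in> S \<Longrightarrow> (x i, branch_at i t) \<in> T"
  using T_repI[OF psi_above[OF x_level]] rep_rep[OF x_Field(1)] by (metis branch_at_def)

lemma branch_at_mono: "(x 0, t) \<in> S \<Longrightarrow> (t, t') \<in> S \<Longrightarrow> (branch_at i t, branch_at i t') \<in> T"
  unfolding branch_at_def using T_repI psi_le_iff[OF x_level] le_trans by metis

lemma branch_at_same_level:
  assumes "(x 0, t) \<in> S" "(x 0, t') \<in> S"
  shows "same_level T (branch_at i t) (branch_at j t') \<longleftrightarrow> same_level S t t'"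
proof -
  have l: "same_level S t (\<psi> (x 0) (x i) t)" "same_level S t' (\<psi> (x 0) (x j) t')"
    using psi_same_level[OF x_level] assms by auto
  have "same_level T (branch_at i t) (branch_at j t') \<longleftrightarrow>
      same_level S (\<psi> (x 0) (x i) t) (\<psi> (x 0) (x j) t')"
    unfolding branch_at_def
    by (rule same_level_T_rep[OF same_level_FieldD(2)[OF l(1)] same_level_FieldD(2)[OF l(2)]])
  then show ?thesis using l same_level_trans same_level_sym by blast
qed

lemma moves_sym: "moves d e q y z \<Longrightarrow> moves e d q z y"
  unfolding moves_def by blast

lemma swaps_sym: "swaps q y z \<Longrightarrow> swaps q z y"
  unfolding swaps_def using moves_sym by blast

lemma moves_mono: "moves d e q y z \<Longrightarrow> (\<And>i. i < k \<Longrightarrow> (q i, q' i) \<in> T) \<Longrightarrow> moves d e q' y z"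
  unfolding moves_def using T.le_trans by blast

lemma swaps_mono: "swaps q y z \<Longrightarrow> (\<And>i. i < k \<Longrightarrow> (q i, q' i) \<in> T) \<Longrightarrow> swaps q' y z"
  unfolding swaps_def using moves_mono by blast

lemma moves_above: "moves d e q y z \<Longrightarrow> (x d, y) \<in> T \<and> (x e, z) \<in> T"
  unfolding moves_def using branch_at_above by blast

text \<open>
  Restrict the coordinate \<open>t'\<close> to the level of \<open>t\<close>. The result agrees with \<open>t\<close> on the \<open>k\<close> branches, as
  both are compatible with \<open>q\<close>, and over \<open>x d\<close>, as \<open>y\<close> lies below \<open>y'\<close>; by joint injectivity for
  these \<open>Suc k = n\<close> cones it equals \<open>t\<close>.
\<close>

lemma moves_le:
  assumes d: "d \<ge> k" and m: "moves d e q y z" "moves d e q y' z'" and le: "(y, y') \<in> T"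
  shows "(z, z') \<in> T"
proof -
  obtain t where t: "(x 0, t) \<in> S" "\<And>i. i < k \<Longrightarrow> (branch_at i t, q i) \<in> T" "y = branch_at d t" "z = branch_at e t"
    using m(1) unfolding moves_def by blast
  obtain t' where t': "(x 0, t') \<in> S" "\<And>i. i < k \<Longrightarrow> (branch_at i t', q i) \<in> T" "y' = branch_at d t'" "z' = branch_at e t'"
    using m(2) unfolding moves_def by blast
  let ?p = "\<psi> (x 0) (x d)"
  have F: "?p t \<in> Field S" "?p t' \<in> Field S"
    using psi_above[OF x_level t(1)] psi_above[OF x_level t'(1)] le_FieldD by blast+
  obtain v where v: "(v, ?p t') \<in> S" "v \<in> cls (?p t)"
    using T_lift_down[OF _ F] le t(3) t'(3) unfolding branch_at_def by blast
  have "same_level S t v" using psi_same_level[OF x_level t(1)] cls_same_level[OF v(2)] same_level_trans by blast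
  moreover obtain w where w: "(w, t') \<in> S" "same_level S v w"
    using counterpart_below_eq[OF same_level_sym[OF psi_same_level[OF x_level t'(1)]] v(1)] by blast
  ultimately have tw: "same_level S t w" using same_level_trans by blast
  have sw: "(x 0, w) \<in> S" by (rule le_transfer[OF same_level_refl[OF x_Field(2)] tw t(1) t'(1) w(1)])
  have eq: "branch_at i t = branch_at i w" if i: "i < k \<or> i = d" for i
  proof -
    have "same_level T (branch_at i t) (branch_at i w)" using branch_at_same_level[OF t(1) sw] tw by simp
    moreover have "(branch_at i w, branch_at i t') \<in> T" by (rule branch_at_mono[OF sw w(1)])
    ultimately show ?thesis using i t t' le T.le_trans T.same_level_below_eq by blast
  qed
  have "t = w"
  proof (rule joint_injectivity[where A = "x ` ({..<k} \<union> {d})", OF _ _ _ _ t(1) sw tw])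
    have "card ({..<k} \<union> {d}) = n" using d n_eq by simp
    then show "card (x ` ({..<k} \<union> {d})) = n" using card_image inj_x by (metis inj_on_subset subset_UNIV)
    fix a assume "a \<in> x ` ({..<k} \<union> {d})"
    then obtain i where i: "i < k \<or> i = d" "a = x i" by auto
    show "\<psi> (x 0) a w \<in> cls (\<psi> (x 0) a t)"
      using eq[OF i(1)] rep_eq_iff psi_above[OF x_level] t(1) sw le_FieldD i(2) unfolding branch_at_def by metis
  qed (use x_level x_indep in auto)
  then show ?thesis using branch_at_mono[OF t(1)] w(1) t(4) t'(4) by blast
qed

text \<open>
  If \<open>q\<close> decides the branches up to the level of \<open>y\<close>, joint surjectivity provides the coordinate of \<open>y\<close>.
\<close>

lemma moves_total:
  assumes d: "d \<ge> k" and y: "(x d, y) \<in> T"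
    and q: "\<And>i. i < k \<Longrightarrow> (x i, q i) \<in> T" "\<And>i. i < k \<Longrightarrow> same_level T (q i) y \<or> ht T y <o ht T (q i)"
  shows "\<exists>z. moves d e q y z"
proof -
  have yF: "y \<in> Field T" using T.le_FieldD[OF y] by simp
  let ?A = "x ` ({..<k} \<union> {d})"
  have "\<exists>v. (x i, v) \<in> S \<and> same_level T (rep v) y \<and> (i < k \<longrightarrow> (rep v, q i) \<in> T) \<and> (i = d \<longrightarrow> rep v = y)"
    if i: "i < k \<or> i = d" for i
  proof (cases "i = d")
    case True
    then show ?thesis using T_lift_up[OF y] T.same_level_refl[OF yF] d by auto
  next
    case False
    then have ik: "i < k" using i by simp
    have qF: "q i \<in> Field T" using T.le_FieldD[OF q(1)[OF ik]] by simp
    have "\<exists>w. (w, q i) \<in> T \<and> same_level T w y"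
    proof (cases "same_level T (q i) y")
      case True then show ?thesis using T.le_refl[OF qF] by blast
    next
      case False
      then obtain w where "w \<in> underS T (q i)" "ht T w =o ht T y" using q(2)[OF ik] T.ht_attained_below by blast
      then show ?thesis using yF T.underS_FieldD underS_le unfolding same_level_def by metis
    qed
    then obtain w where w: "(w, q i) \<in> T" "same_level T w y" by blast
    have "(x i, w) \<in> T" by (rule T.le_transfer[OF x_level_T T.same_level_sym[OF w(2)] y q(1)[OF ik] w(1)])
    then show ?thesis using T_lift_up w False by metis
  qed
  then obtain u' where u': "\<And>i. i < k \<or> i = d \<Longrightarrow> (x i, u' i) \<in> S \<and> same_level T (rep (u' i)) y \<and>
    (i < k \<longrightarrow> (rep (u' i), q i) \<in> T) \<and> (i = d \<longrightarrow> rep (u' i) = y)" by metis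
  define u where "u = u' \<circ> inv x"
  have ux: "u (x i) = u' i" for i by (simp add: u_def inv_f_f[OF inj_x])
  have fin: "finite ?A" by simp
  have xd: "x d \<in> ?A" by simp
  have lev: "same_level S (x 0) a" if "a \<in> ?A" for a using that x_level by auto
  have ind: "a = b" if "a \<in> ?A" "b \<in> ?A" "b \<in> cls a" for a b using that x_indep by auto
  have card: "card ?A \<le> n" using card_image_le[of "{..<k} \<union> {d}" x] d n_eq by simp
  have above: "(a, u a) \<in> S" if "a \<in> ?A" for a using that u' ux by auto
  have ul: "same_level S (u a) (u b)" if a: "a \<in> ?A" and b: "b \<in> ?A" for a b
  proof -
    have "same_level T (rep (u a)) y" "same_level T (rep (u b)) y" using a b u' ux by auto
    then have "same_level T (rep (u a)) (rep (u b))" using T.same_level_trans T.same_level_sym by blast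
    then show ?thesis using same_level_T_rep le_FieldD(2)[OF above[OF a]] le_FieldD(2)[OF above[OF b]] by blast
  qed
  obtain t where t: "(x 0, t) \<in> S" "\<And>a. a \<in> ?A \<Longrightarrow> \<psi> (x 0) a t \<in> cls (u a)"
    using joint_surjectivity[OF fin lev ind card xd above ul] by blast
  have b: "branch_at i t = rep (u' i)" if i: "i < k \<or> i = d" for i
  proof -
    have "\<psi> (x 0) (x i) t \<in> cls (u' i)" using t(2)[of "x i"] i ux by auto
    then show ?thesis unfolding branch_at_def using rep_eq_iff cls_same_level same_level_FieldD by metis
  qed
  have "moves d e q y (branch_at e t)"
    unfolding moves_def by (intro exI[of _ t]) (use t(1) b u' in auto)
  then show ?thesis by blast
qed

lemma swaps_Field: assumes "swaps q y z" shows "y \<in> Field T" "z \<in> Field T"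
  using assms moves_above T.le_FieldD unfolding swaps_def by blast+

text \<open>
  Inside the cones this is \<open>moves_le\<close>, and nodes of different cones are incomparable. A fixed node \<open>y\<close>
  below a moved node lies below or at the common immediate predecessor \<open>stem\<close> of \<open>x k\<close> and \<open>x (Suc k)\<close>, hence below
  both cones.
\<close>

lemma swaps_le:
  assumes s: "swaps q y z" "swaps q y' z'" and le: "(y, y') \<in> T" shows "(z, z') \<in> T"
proof -
  have ne: "x k \<noteq> x (Suc k)" using inj_x by (metis injD n_not_Suc_n)
  have from_fixed: "(y, z') \<in> T" if f: "(x d, y) \<notin> T" and m: "moves d e q y' z'" for d e
  proof -
    have "(y, x d) \<in> T" "y \<noteq> x d"
      using T.comparable[OF le] moves_above[OF m] f T.le_refl[OF x_Field(1)] by auto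
    then have "(y, stem) \<in> T" using T.below_imm_succ[OF x_imm] underS_I by metis
    then have "(y, x e) \<in> T" using T.le_underS_trans T.imm_succ_underS[OF x_imm] underS_le by metis
    then show ?thesis using moves_above[OF m] T.le_trans by blast
  qed
  have to_fixed: False if f: "(x d, y') \<notin> T" and m: "moves d e q y z" for d e
    using moves_above[OF m] le f T.le_trans by blast
  have opposite: False if "moves d e q y z" "moves e d q y' z'" "d \<noteq> e" for d e
    using moves_above[OF that(1)] moves_above[OF that(2)] le T.le_trans x_disjoint that(3) by blast
  show ?thesis
    using s unfolding swaps_def
  proof (elim disjE conjE)
    assume "moves k (Suc k) q y z" "moves k (Suc k) q y' z'"
    then show ?thesis using moves_le[of k] le by blast
  next
    assume "moves (Suc k) k q y z" "moves (Suc k) k q y' z'"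
    then show ?thesis using moves_le[of "Suc k"] le by simp
  qed (use le from_fixed to_fixed opposite[of k "Suc k"] opposite[of "Suc k" k] in auto)
qed

lemma swaps_not_fixed: "\<not> swaps q (x k) (x k)"
proof
  assume "swaps q (x k) (x k)"
  then have "moves k (Suc k) q (x k) (x k) \<or> moves (Suc k) k q (x k) (x k)"
    unfolding swaps_def using T.le_refl[OF x_Field(1)] by blast
  then have "(x k, x k) \<in> T" "(x (Suc k), x k) \<in> T" using moves_above by blast+
  then show False using x_disjoint by (metis n_not_Suc_n)
qed

abbreviation stronger :: "(nat \<Rightarrow> 'a) rel" where
  "stronger \<equiv> (product_power k T)\<inverse>"

text \<open>
  The name of the graph of the automorphism that exchanges the two cones and fixes all other nodes.
\<close>

definition swap_name :: "(('a \<times> 'a) \<times> (nat \<Rightarrow> 'a)) set" where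
  "swap_name = {((y, z), q). q \<in> (\<Pi>\<^sub>E i\<in>{..<k}. Field T) \<and> swaps q y z}"

lemma stronger_iff: "(q, p) \<in> stronger \<longleftrightarrow> p \<in> (\<Pi>\<^sub>E i\<in>{..<k}. Field T) \<and> q \<in> (\<Pi>\<^sub>E i\<in>{..<k}. Field T) \<and> (\<forall>i<k. (p i, q i) \<in> T)"
  by (simp add: product_power_def)

lemma stronger_refl: "q \<in> (\<Pi>\<^sub>E i\<in>{..<k}. Field T) \<Longrightarrow> (q, q) \<in> stronger"
  unfolding stronger_iff using T.le_refl by (auto simp: PiE_def)

lemma stronger_trans:
  assumes "(r, q) \<in> stronger" "(q, p) \<in> stronger" shows "(r, p) \<in> stronger"
proof -
  have "(p i, r i) \<in> T" if "i < k" for i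
    by (rule T.le_trans[of _ "q i"]) (use assms that stronger_iff in blast)+
  then show ?thesis using assms stronger_iff by blast
qed

lemma Field_stronger: "Field stronger = (\<Pi>\<^sub>E i\<in>{..<k}. Field T)"
proof -
  have "q \<in> Field stronger" if "q \<in> (\<Pi>\<^sub>E i\<in>{..<k}. Field T)" for q
    using stronger_refl[OF that] by (rule FieldI1)
  moreover have "q \<in> (\<Pi>\<^sub>E i\<in>{..<k}. Field T)" if "q \<in> Field stronger" for q
  proof -
    obtain p where "(q, p) \<in> stronger \<or> (p, q) \<in> stronger" using \<open>q \<in> Field stronger\<close> unfolding Field_def by blast
    then show ?thesis using stronger_iff by blast
  qed
  ultimately show ?thesis by blast
qed

lemma forces_swap:
  assumes "q \<in> (\<Pi>\<^sub>E i\<in>{..<k}. Field T)" "swaps q y z" shows "f_mem stronger (y, z) swap_name q"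
  unfolding f_mem_def swap_name_def using assms stronger_refl stronger_iff by blast

lemma swaps_if_forced:
  assumes "q \<in> (\<Pi>\<^sub>E i\<in>{..<k}. Field T)" "f_mem stronger (y, z) swap_name q"
  shows "\<exists>r. (r, q) \<in> stronger \<and> swaps r y z"
proof -
  obtain r s where r: "(r, q) \<in> stronger" "((y, z), s) \<in> swap_name" "(r, s) \<in> stronger"
    using assms stronger_refl unfolding f_mem_def by blast
  have "swaps s y z" using r(2) by (simp add: swap_name_def)
  then have "swaps r y z" by (rule swaps_mono) (use r(3) stronger_iff in blast)
  then show ?thesis using r(1) by blast
qed

lemma f_mem_stronger: "f_mem stronger u F q \<Longrightarrow> (r, q) \<in> stronger \<Longrightarrow> f_mem stronger u F r"
  unfolding f_mem_def using stronger_trans by blast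

text \<open>
  Lengthen the condition in all coordinates until it reaches the level of \<open>y\<close>.
\<close>

lemma swaps_dense:
  assumes q: "q \<in> (\<Pi>\<^sub>E i\<in>{..<k}. Field T)" "\<And>i. i < k \<Longrightarrow> (x i, q i) \<in> T" and y: "y \<in> Field T"
  shows "\<exists>r z. (r, q) \<in> stronger \<and> swaps r y z"
proof (cases "(x k, y) \<in> T \<or> (x (Suc k), y) \<in> T")
  case False
  then have "swaps q y y" using y unfolding swaps_def by blast
  then show ?thesis using stronger_refl[OF q(1)] by blast
next
  case True
  have "\<exists>v. (q i, v) \<in> T \<and> (same_level T v y \<or> ht T y <o ht T v)" if i: "i < k" for i
  proof -
    have qF: "q i \<in> Field T" using q(1) i by auto
    show ?thesis by (rule T.extend_to_level[OF qF y])
  qed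
  then obtain r' where r': "\<And>i. i < k \<Longrightarrow> (q i, r' i) \<in> T" "\<And>i. i < k \<Longrightarrow> same_level T (r' i) y \<or> ht T y <o ht T (r' i)"
    by metis
  define r where "r = restrict r' {..<k}"
  have "r \<in> (\<Pi>\<^sub>E i\<in>{..<k}. Field T)" using T.le_FieldD(2)[OF r'(1)] by (auto simp: r_def)
  then have rq: "(r, q) \<in> stronger" unfolding stronger_iff using q(1) r'(1) by (auto simp: r_def)
  have r: "(x i, r i) \<in> T" "same_level T (r i) y \<or> ht T y <o ht T (r i)" if "i < k" for i
    using that r'(2) T.le_trans[OF q(2) r'(1)] by (auto simp: r_def)
  from True obtain z where "swaps r y z"
  proof (elim disjE)
    assume "(x k, y) \<in> T"
    from moves_total[OF order_refl this r] show ?thesis using that unfolding swaps_def by blast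
  next
    assume "(x (Suc k), y) \<in> T"
    from moves_total[OF _ this r] show ?thesis using that unfolding swaps_def by (meson le_SucI order_refl)
  qed
  then show ?thesis using rq by blast
qed

lemma f_ex_if_dense:
  assumes "\<And>q. (q, p) \<in> P \<Longrightarrow> \<exists>r z. (r, q) \<in> P \<and> z \<in> X \<and> \<phi> z r" shows "f_ex P X \<phi> p"
  unfolding f_ex_def f_neg_def f_all_def using assms by blast

text \<open>
  The condition \<open>p\<close> forces that the name is an automorphism, being total and surjective by density
  and order preserving by \<open>swaps_le\<close>, and that it is not the identity, as no condition forces \<open>x k\<close> to be fixed.
\<close>

lemma not_absolutely_rigid: "\<not> absolutely_rigid k T"
proof -
  let ?N = "\<Pi>\<^sub>E i\<in>{..<k}. Field T"
  define p where "p = restrict x {..<k}"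
  have p: "p \<in> ?N" using x_Field by (auto simp: p_def)
  have below_p: "q \<in> ?N" "\<And>i. i < k \<Longrightarrow> (x i, q i) \<in> T" if "(q, p) \<in> stronger" for q
    using that unfolding stronger_iff p_def by auto
  have name: "swap_name \<in> names stronger (Field T \<times> Field T)"
    unfolding names_def Field_stronger swap_name_def using swaps_Field by blast
  have total: "f_ex stronger (Field T) (\<lambda>z. f_mem stronger (y, z) swap_name) p" if y: "y \<in> Field T" for y
  proof (rule f_ex_if_dense)
    fix q assume "(q, p) \<in> stronger"
    from swaps_dense[OF below_p[OF this] y] obtain r z where r: "(r, q) \<in> stronger" "swaps r y z" by blast
    then have "f_mem stronger (y, z) swap_name r" using forces_swap stronger_iff by blast
    then show "\<exists>r z. (r, q) \<in> stronger \<and> z \<in> Field T \<and> f_mem stronger (y, z) swap_name r"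
      using r swaps_Field by blast
  qed
  have surj: "f_ex stronger (Field T) (\<lambda>y. f_mem stronger (y, z) swap_name) p" if z: "z \<in> Field T" for z
  proof (rule f_ex_if_dense)
    fix q assume "(q, p) \<in> stronger"
    from swaps_dense[OF below_p[OF this] z] obtain r y where r: "(r, q) \<in> stronger" "swaps r z y" by blast
    then have "f_mem stronger (y, z) swap_name r" using forces_swap swaps_sym stronger_iff by blast
    then show "\<exists>r y. (r, q) \<in> stronger \<and> y \<in> Field T \<and> f_mem stronger (y, z) swap_name r"
      using r swaps_Field by blast
  qed
  have iso: "(y = y' \<longleftrightarrow> z = z') \<and> ((y, y') \<in> T \<longleftrightarrow> (z, z') \<in> T)"
    if q: "(q, p) \<in> stronger" "f_mem stronger (y, z) swap_name q" "f_mem stronger (y', z') swap_name q" for q y y' z z'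
  proof -
    obtain r where r: "(r, q) \<in> stronger" "swaps r y z" using swaps_if_forced[OF below_p(1)[OF q(1)] q(2)] by blast
    have rN: "r \<in> ?N" using r(1) stronger_iff by blast
    obtain r' where r': "(r', r) \<in> stronger" "swaps r' y' z'"
      using swaps_if_forced[OF rN f_mem_stronger[OF q(3) r(1)]] by blast
    have s: "swaps r' y z" by (rule swaps_mono[OF r(2)]) (use r'(1) stronger_iff in blast)
    have le: "(y, y') \<in> T \<longleftrightarrow> (z, z') \<in> T" "(y', y) \<in> T \<longleftrightarrow> (z', z) \<in> T"
      using swaps_le[OF s r'(2)] swaps_le[OF r'(2) s] swaps_le[OF swaps_sym[OF s] swaps_sym[OF r'(2)]]
        swaps_le[OF swaps_sym[OF r'(2)] swaps_sym[OF s]] by blast+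
    have "y = y' \<longleftrightarrow> (y, y') \<in> T \<and> (y', y) \<in> T" "z = z' \<longleftrightarrow> (z, z') \<in> T \<and> (z', z) \<in> T"
      using T.le_antisym T.le_refl swaps_Field[OF s] by blast+
    then show ?thesis using le by blast
  qed
  have auto: "f_automorphism stronger T swap_name p"
    unfolding f_automorphism_def f_and_def f_all_def
  proof (intro conjI ballI)
    fix y y' z z'
    show "f_imp stronger (\<lambda>p. f_mem stronger (y, z) swap_name p \<and> f_mem stronger (y', z') swap_name p)
        (\<lambda>p. f_ground (y = y' \<longleftrightarrow> z = z') p \<and> f_ground ((y, y') \<in> T \<longleftrightarrow> (z, z') \<in> T) p) p"
      unfolding f_imp_def f_neg_def f_and_def f_ground_def
      using iso[of _ y z y' z'] stronger_refl below_p(1) by blast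
  qed (use total surj in auto)
  have "\<not> f_mem stronger (x k, x k) swap_name q" if "q \<in> ?N" for q
    using swaps_if_forced[OF that] swaps_not_fixed by blast
  then have "f_neg stronger (f_all (Field T) (\<lambda>y. f_mem stronger (y, y) swap_name)) p"
    unfolding f_neg_def f_all_def using x_Field(1)[of k] below_p(1) by blast
  then have "\<not> f_imp stronger (f_automorphism stronger T swap_name) (f_all (Field T) (\<lambda>y. f_mem stronger (y, y) swap_name)) p"
    unfolding f_imp_def f_and_def f_neg_def[of stronger "\<lambda>p. _ p \<and> _ p"] using auto stronger_refl[OF p] by blast
  then have "\<not> f_rigid stronger T p"
    unfolding f_rigid_def f_all_def[of "names _ _"] using name by blast
  moreover have "p \<in> Field stronger" using p Field_stronger by simp
  ultimately show ?thesis unfolding absolutely_rigid_def by blast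
qed

end

lemma T_not_absolutely_rigid: "\<not> absolutely_rigid (n - 1) T"
proof -
  obtain stem where stem: "stem \<in> Field T" using T_normal unfolding normal_tree_def by blast
  obtain x :: "nat \<Rightarrow> 'a" where x: "inj x" "range x \<subseteq> imm_succs T stem"
    using infinite_countable_subset[OF infinite_imm_succs_T[OF stem]] by blast
  have "n = Suc (n - 1)" using n_pos by simp
  from not_absolutely_rigid[OF this x(1)] show ?thesis using x(2) by blast
qed

end

theorem corollary3p7:
  fixes n :: nat
  assumes "n > 1"
    and "\<exists>S :: 'a rel. strongly_homogeneous S"
  shows "\<exists>T :: 'a rel. n_free n T \<and> \<not> absolutely_rigid (n - 1) T"
proof -
  obtain S :: "'a rel" and \<psi> where S: "souslin_tree S" "coherent_family S \<psi>"
    using assms(2) unfolding strongly_homogeneous_def by blast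
  interpret interpolation_quotient S \<psi> n
    by unfold_locales (use S assms(1) in \<open>simp_all add: souslin_tree_def\<close>)
  show ?thesis using T_n_free T_not_absolutely_rigid by blast
qed

end
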